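(* There is a polynomial-time algorithm which, given a finite tree $T$, outputs an edge 2-coloring of $T$ whose largest color group has minimum possible size among all edge 2-colorings of $T$ (together with that minimum size).
   Context: An edge 2-coloring of a graph is an assignment of colors to its edges such that each vertex is incident to edges of at most 2 distinct colors. A color group is the set of all edges receiving a given color. *)

theory Defs
  imports "HOL-Computational_Algebra.Polynomial"
begin

section \<open>Finite trees and edge 2-colorings\<close>

definition simple_graph :: "'a set \<Rightarrow> 'a set set \<Rightarrow> bool" where
  "simple_graph V E \<longleftrightarrow> finite V \<and> (\<forall>e\<in>E. e \<subseteq> V \<and> card e = 2)"

definition is_walk :: "'a set \<Rightarrow> 'a set set \<Rightarrow> 'a list \<Rightarrow> bool" where
  "is_walk V E p \<longleftrightarrow> p \<noteq> [] \<and> set p \<subseteq> V \<and> successively (\<lambda>u v. {u, v} \<in> E) p"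

definition connected_graph :: "'a set \<Rightarrow> 'a set set \<Rightarrow> bool" where
  "connected_graph V E \<longleftrightarrow>
     V \<noteq> {} \<and> (\<forall>u\<in>V. \<forall>v\<in>V. \<exists>p. is_walk V E p \<and> hd p = u \<and> last p = v)"

text \<open>A cycle is given by the list of its vertices, without repeating the first one at the end.\<close>

definition is_cycle :: "'a set \<Rightarrow> 'a set set \<Rightarrow> 'a list \<Rightarrow> bool" where
  "is_cycle V E p \<longleftrightarrow>
     is_walk V E p \<and> distinct p \<and> length p \<ge> 3 \<and> {last p, hd p} \<in> E"

definition finite_tree :: "'a set \<Rightarrow> 'a set set \<Rightarrow> bool" where
  "finite_tree V E \<longleftrightarrow>
     simple_graph V E \<and> connected_graph V E \<and> (\<nexists>p. is_cycle V E p)"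

definition edge_2_coloring :: "'a set \<Rightarrow> 'a set set \<Rightarrow> ('a set \<Rightarrow> 'c) \<Rightarrow> bool" where
  "edge_2_coloring V E col \<longleftrightarrow> (\<forall>v\<in>V. card (col ` {e \<in> E. v \<in> e}) \<le> 2)"

definition color_group :: "'a set set \<Rightarrow> ('a set \<Rightarrow> 'c) \<Rightarrow> 'c \<Rightarrow> 'a set set" where
  "color_group E col c = {e \<in> E. col e = c}"

text \<open>The maximum ranges over all colors, used or not; for a finite edge set only finitely
  many values occur, and the maximum is 0 for a graph without edges.\<close>

definition largest_group_size :: "'a set set \<Rightarrow> ('a set \<Rightarrow> 'c) \<Rightarrow> nat" where
  "largest_group_size E col = Max (range (\<lambda>c. card (color_group E col c)))"

section \<open>A model of computation\<close>

text \<open>A first-order functional language over binary trees (Lisp without atoms other than nil),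
  evaluated call-by-value with unit cost per evaluation step, as in Jones,
  ``Computability and Complexity from a Programming Perspective''. A program is a list of
  function bodies, which may call each other recursively; in a body, variable \<open>i\<close> is the
  \<open>i\<close>-th entry of the environment, which consists of the variables bound by
  \<open>ELet\<close> (innermost first) followed by the arguments of the call.

  All values are handled by reference on a pointer machine, so every rule is a bounded number
  of machine steps for a fixed program, and the model is polynomially equivalent to Turing
  machines.\<close>

datatype sexp = Leaf | Node (left: sexp) (right: sexp)
  where
    "left Leaf = Leaf"
  | "right Leaf = Leaf"

datatype expr =
    EVar nat
  | ENil
  | ECons expr expr
  | EHd expr
  | ETl expr
  | EIf expr expr expr
  | ELet expr expr
  | ECall nat "expr list"

type_synonym program = "expr list"

text \<open>\<open>eval P env e v t\<close>: in program \<open>P\<close> and environment \<open>env\<close>, the expression \<open>e\<close> evaluates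
  to \<open>v\<close> in \<open>t\<close> steps. Undefined variables and functions get stuck.\<close>

inductive
  eval :: "program \<Rightarrow> sexp list \<Rightarrow> expr \<Rightarrow> sexp \<Rightarrow> nat \<Rightarrow> bool" and
  evals :: "program \<Rightarrow> sexp list \<Rightarrow> expr list \<Rightarrow> sexp list \<Rightarrow> nat \<Rightarrow> bool"
  for P :: program
where
  eval_Var: "i < length env \<Longrightarrow> eval P env (EVar i) (env ! i) 1"
| eval_Nil: "eval P env ENil Leaf 1"
| eval_Cons: "eval P env a v s \<Longrightarrow> eval P env b w t
    \<Longrightarrow> eval P env (ECons a b) (Node v w) (s + t + 1)"
| eval_Hd: "eval P env a v t \<Longrightarrow> eval P env (EHd a) (left v) (t + 1)"
| eval_Tl: "eval P env a v t \<Longrightarrow> eval P env (ETl a) (right v) (t + 1)"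
| eval_If_True: "eval P env c v s \<Longrightarrow> v \<noteq> Leaf \<Longrightarrow> eval P env a w t
    \<Longrightarrow> eval P env (EIf c a b) w (s + t + 1)"
| eval_If_False: "eval P env c v s \<Longrightarrow> v = Leaf \<Longrightarrow> eval P env b w t
    \<Longrightarrow> eval P env (EIf c a b) w (s + t + 1)"
| eval_Let: "eval P env a v s \<Longrightarrow> eval P (v # env) b w t
    \<Longrightarrow> eval P env (ELet a b) w (s + t + 1)"
| eval_Call: "f < length P \<Longrightarrow> evals P env as vs s \<Longrightarrow> eval P vs (P ! f) w t
    \<Longrightarrow> eval P env (ECall f as) w (s + t + 1)"
| evals_Nil: "evals P env [] [] 0"
| evals_Cons: "eval P env a v s \<Longrightarrow> evals P env as vs t
    \<Longrightarrow> evals P env (a # as) (v # vs) (s + t)"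

inductive_cases eval_VarE: "eval P env (EVar i) v t"
inductive_cases eval_NilE: "eval P env ENil v t"
inductive_cases eval_ConsE: "eval P env (ECons a b) v t"
inductive_cases eval_HdE: "eval P env (EHd a) v t"
inductive_cases eval_TlE: "eval P env (ETl a) v t"
inductive_cases eval_IfE: "eval P env (EIf c a b) v t"
inductive_cases eval_LetE: "eval P env (ELet a b) v t"
inductive_cases eval_CallE: "eval P env (ECall f as) v t"
inductive_cases evals_NilE: "evals P env [] vs t"
inductive_cases evals_ConsE: "evals P env (a # as) vs t"

lemma eval_deterministic:
  "eval P env e v t \<Longrightarrow> eval P env e v' t' \<Longrightarrow> v' = v \<and> t' = t"
  "evals P env es vs s \<Longrightarrow> evals P env es vs' s' \<Longrightarrow> vs' = vs \<and> s' = s"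
proof (induction arbitrary: v' t' and vs' s' rule: eval_evals.inducts)
  case eval_Var then show ?case by (auto elim: eval_VarE)
next
  case eval_Nil then show ?case by (auto elim: eval_NilE)
next
  case eval_Cons
  from eval_Cons.prems show ?case by (rule eval_ConsE) (auto dest!: eval_Cons.IH(2,4))
next
  case eval_Hd
  from eval_Hd.prems show ?case by (rule eval_HdE) (auto dest!: eval_Hd.IH(2))
next
  case eval_Tl
  from eval_Tl.prems show ?case by (rule eval_TlE) (auto dest!: eval_Tl.IH(2))
next
  case eval_If_True
  from eval_If_True.prems eval_If_True.hyps show ?case
    by - (erule eval_IfE; auto dest!: eval_If_True.IH(2,4))
next
  case eval_If_False
  from eval_If_False.prems eval_If_False.hyps show ?case
    by - (erule eval_IfE; auto dest!: eval_If_False.IH(2,4))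
next
  case eval_Let
  from eval_Let.prems show ?case
    by - (erule eval_LetE, drule eval_Let.IH(2), clarify, drule eval_Let.IH(4), simp)
next
  case eval_Call
  from eval_Call.prems show ?case
    by - (erule eval_CallE, drule eval_Call.IH(3), clarify, drule eval_Call.IH(5), simp)
next
  case evals_Nil then show ?case by (auto elim: evals_NilE)
next
  case evals_Cons
  from evals_Cons.prems show ?case by (rule evals_ConsE) (auto dest!: evals_Cons.IH(2,4))
qed

text \<open>Function 0 is the entry point. The time includes writing the output out as a
  tree: evaluation alone could build, by sharing, an output of exponential size.\<close>

definition computes_in_time :: "program \<Rightarrow> sexp \<Rightarrow> sexp \<Rightarrow> nat \<Rightarrow> bool" where
  "computes_in_time P x y t \<longleftrightarrow> (\<exists>s. eval P [x] (ECall 0 [EVar 0]) y s \<and> t = s + size y)"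

section \<open>Input and output of the algorithm\<close>

fun enc_nat :: "nat \<Rightarrow> sexp" where
  "enc_nat 0 = Leaf"
| "enc_nat (Suc n) = Node Leaf (enc_nat n)"

fun enc_list :: "('a \<Rightarrow> sexp) \<Rightarrow> 'a list \<Rightarrow> sexp" where
  "enc_list f [] = Leaf"
| "enc_list f (x # xs) = Node (f x) (enc_list f xs)"

fun enc_pair :: "('a \<Rightarrow> sexp) \<Rightarrow> ('b \<Rightarrow> sexp) \<Rightarrow> 'a \<times> 'b \<Rightarrow> sexp" where
  "enc_pair f g (x, y) = Node (f x) (g y)"

definition edge_of :: "nat \<times> nat \<Rightarrow> nat set" where
  "edge_of = (\<lambda>(u, v). {u, v})"

text \<open>An input tree is presented by its number \<open>n\<close> of vertices, which are named
  \<open>0, \<dots>, n - 1\<close>, and a list of its edges, each listed once, in any order and with its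
  endpoints in either order. Numbers are in unary; the vertex names being less than \<open>n\<close>, the
  length of the input is polynomial in \<open>n\<close>.\<close>

definition presents_tree :: "nat \<Rightarrow> (nat \<times> nat) list \<Rightarrow> bool" where
  "presents_tree n es \<longleftrightarrow>
     distinct (map edge_of es) \<and> finite_tree {..<n} (edge_of ` set es)"

definition enc_input :: "nat \<Rightarrow> (nat \<times> nat) list \<Rightarrow> sexp" where
  "enc_input n es = enc_pair enc_nat (enc_list (enc_pair enc_nat enc_nat)) (n, es)"

text \<open>The output is the size of the largest color group and the list of the colors of the
  edges, in the order in which the input lists the edges.\<close>

definition enc_output :: "nat \<Rightarrow> (nat \<times> nat) list \<Rightarrow> (nat set \<Rightarrow> nat) \<Rightarrow> sexp" where
  "enc_output k es col =
     enc_pair enc_nat (enc_list enc_nat) (k, map (\<lambda>e. col (edge_of e)) es)"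

end

theory Submission
  imports Defs
begin

text \<open>Root the tree at 0 and fix a bound \<open>k\<close>. At a vertex, the edges to the children either inherit
  the color of the edge to the parent or get a second color, which can be fresh. Going up from the
  leaves, it is best to make the group of the edge to the parent as small as possible, that is, to
  give the second color to edges whose groups have the largest total size not exceeding \<open>k\<close>. This is
  a subset sum problem with unary numbers, hence solved by dynamic programming. The tree has a
  coloring with bound \<open>k\<close> iff no inherited total ever exceeds \<open>k\<close>, and the least such \<open>k\<close> is found by
  trying \<open>0, 1, \<dots>\<close>. Both directions follow from one potential (\<open>load\<close> below), which an arbitrary
  coloring keeps at most \<open>k\<close> while the leaves are removed, and which the computed coloring keeps
  at most \<open>k\<close> while they are put back.\<close>

section \<open>Symbolic evaluation\<close>

text \<open>A fresh second color loses nothing: recoloring with it cuts groups into smaller pieces,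
  and the number of colors is unlimited. In a coloring of this kind, exactly one group of the
  subtree below an edge can still grow, namely that of the edge itself; the others are final and
  only have to respect \<open>k\<close>. One number thus summarizes a subtree, and a smaller number
  is never worse. The obstacle to proving optimality is that an arbitrary coloring may reuse a color
  in distant parts of the tree and need not split any vertex the way the algorithm does, so groups
  cannot be compared edge by edge. The potential therefore combines the weights chosen by the
  algorithm with the colors of the given coloring. Inherited colors are unknown on the way up. They
  are recorded as marks and resolved when the recursion returns, from the root downwards.\<close>

definition wp :: "program \<Rightarrow> sexp list \<Rightarrow> expr \<Rightarrow> (sexp \<Rightarrow> nat \<Rightarrow> bool) \<Rightarrow> bool" where
  "wp P env e Q \<longleftrightarrow> (\<exists>v t. eval P env e v t \<and> Q v t)"

definition wps :: "program \<Rightarrow> sexp list \<Rightarrow> expr list \<Rightarrow> (sexp list \<Rightarrow> nat \<Rightarrow> bool) \<Rightarrow> bool" where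
  "wps P env es Q \<longleftrightarrow> (\<exists>vs t. evals P env es vs t \<and> Q vs t)"

text \<open>Kept apart from \<open>wp\<close> so that the simplifier executes a body only up to its
  next call. There a specification of the form \<open>calls\<close> takes over; otherwise recursive
  bodies would unfold forever.\<close>

definition wp_call :: "program \<Rightarrow> nat \<Rightarrow> sexp list \<Rightarrow> (sexp \<Rightarrow> nat \<Rightarrow> bool) \<Rightarrow> bool" where
  "wp_call P f vs Q \<longleftrightarrow> wp P vs (P ! f) Q"

definition calls :: "program \<Rightarrow> nat \<Rightarrow> sexp list \<Rightarrow> sexp \<Rightarrow> nat \<Rightarrow> bool" where
  "calls P f vs v T \<longleftrightarrow> wp_call P f vs (\<lambda>w t. w = v \<and> t \<le> T)"

text \<open>As congruence rules, these keep the simplifier out of the continuation until the values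
  it depends on have been computed.\<close>

lemma wp_cong [cong]: "env = env' \<Longrightarrow> e = e' \<Longrightarrow> wp P env e Q = wp P env' e' Q"
  and wps_cong [cong]: "env = env' \<Longrightarrow> wps P env es R = wps P env' es R"
  and wp_call_cong [cong]: "vs = vs' \<Longrightarrow> wp_call P f vs Q = wp_call P f vs' Q"
  by simp_all

lemmas eval_intros =
  eval_Var[simplified] eval_Nil[simplified] eval_Cons[simplified] eval_Hd[simplified]
  eval_Tl[simplified] eval_If_True[simplified] eval_If_False[simplified] eval_Let[simplified]
  eval_Call[simplified]

lemma wp_Var [simp]: "i < length env \<Longrightarrow> wp P env (EVar i) Q = Q (env ! i) (Suc 0)"
  unfolding wp_def by (auto elim!: eval_VarE intro: eval_intros)

lemma wp_Nil [simp]: "wp P env ENil Q = Q Leaf (Suc 0)"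
  unfolding wp_def by (auto elim!: eval_NilE intro: eval_intros)

lemma wp_Cons [simp]:
  "wp P env (ECons a b) Q = wp P env a (\<lambda>v s. wp P env b (\<lambda>w t. Q (Node v w) (Suc (s + t))))"
  unfolding wp_def by (rule iffI; elim exE conjE eval_ConsE) (blast intro: eval_intros)+

lemma wp_Hd [simp]: "wp P env (EHd a) Q = wp P env a (\<lambda>v t. Q (left v) (Suc t))"
  unfolding wp_def by (rule iffI; elim exE conjE eval_HdE) (blast intro: eval_intros)+

lemma wp_Tl [simp]: "wp P env (ETl a) Q = wp P env a (\<lambda>v t. Q (right v) (Suc t))"
  unfolding wp_def by (rule iffI; elim exE conjE eval_TlE) (blast intro: eval_intros)+

lemma wp_If [simp]:
  "wp P env (EIf c a b) Q =
     wp P env c (\<lambda>v s. wp P env (if v = Leaf then b else a) (\<lambda>w t. Q w (Suc (s + t))))"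
  unfolding wp_def
proof (rule iffI; elim exE conjE)
  fix w t assume "eval P env (EIf c a b) w t" "Q w t"
  then show "\<exists>v s. eval P env c v s \<and>
      (\<exists>w t. eval P env (if v = Leaf then b else a) w t \<and> Q w (Suc (s + t)))"
    by (elim eval_IfE) (rule exI, rule exI, erule conjI, auto)+
next
  fix v s w t
  assume "eval P env c v s" "eval P env (if v = Leaf then b else a) w t" "Q w (Suc (s + t))"
  then show "\<exists>v t. eval P env (EIf c a b) v t \<and> Q v t"
    by (cases "v = Leaf") (auto intro: eval_intros)
qed

lemma wp_Let [simp]:
  "wp P env (ELet a b) Q = wp P env a (\<lambda>v s. wp P (v # env) b (\<lambda>w t. Q w (Suc (s + t))))"
  unfolding wp_def by (rule iffI; elim exE conjE eval_LetE) (blast intro: eval_intros)+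

lemma wp_Call [simp]:
  "f < length P \<Longrightarrow> wp P env (ECall f as) Q =
     wps P env as (\<lambda>vs s. wp_call P f vs (\<lambda>w t. Q w (Suc (s + t))))"
  unfolding wp_def wps_def wp_call_def
  by (rule iffI; elim exE conjE eval_CallE) (blast intro: eval_intros)+

lemma wps_Nil [simp]: "wps P env [] R = R [] 0"
  unfolding wps_def by (auto elim!: evals_NilE intro: evals_Nil)

lemma wps_Cons [simp]:
  "wps P env (a # as) R = wp P env a (\<lambda>v s. wps P env as (\<lambda>vs t. R (v # vs) (s + t)))"
  unfolding wp_def wps_def by (rule iffI; elim exE conjE evals_ConsE) (blast intro: evals_Cons)+

lemma wp_call_calls:
  assumes "calls P f vs v T" and "\<And>t. t \<le> T \<Longrightarrow> Q v t"
  shows "wp_call P f vs Q"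
  using assms by (auto simp: calls_def wp_call_def wp_def)

lemma calls_mono: "calls P f vs v S \<Longrightarrow> S \<le> T \<Longrightarrow> calls P f vs v T"
  by (auto simp: calls_def wp_call_def wp_def intro: order_trans)

section \<open>The algorithm\<close>

type_synonym edge = "nat \<times> nat"
text \<open>An entry \<open>(c, p, e)\<close> of a rooted tree, listed leaves first, is a vertex \<open>c\<close> with parent \<open>p\<close>
  and the edge \<open>e\<close> between them, oriented as in the input. The root has the entry
  \<open>(0, 0, (0, 0))\<close>; its dummy edge \<open>(0, 0)\<close> has color 0. An item \<open>(p, f, e)\<close> is an edge \<open>e\<close> from \<open>p\<close>
  down to a processed vertex, where \<open>f\<close> is the number of edges that the group of \<open>e\<close> has
  so far.\<close>

type_synonym vertex_entry = "nat \<times> nat \<times> edge"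
type_synonym item = "nat \<times> nat \<times> edge"
type_synonym split = "nat \<times> (nat \<times> edge) list"

fun find_edge :: "edge list \<Rightarrow> nat set \<Rightarrow> vertex_entry option" where
  "find_edge [] S = None"
| "find_edge ((u, v) # es) S =
     (if u \<in> S \<and> v \<notin> S then Some (v, u, u, v)
      else if u \<notin> S \<and> v \<in> S then Some (u, v, u, v)
      else find_edge es S)"

text \<open>The number is fuel. Each round attaches one vertex as a leaf, so the head of the list is
  always a leaf of the tree formed by the whole list; this gives the order in which
  \<open>solve\<close> consumes vertices.\<close>

fun grow :: "nat \<Rightarrow> edge list \<Rightarrow> vertex_entry list \<Rightarrow> vertex_entry list" where
  "grow 0 es ord = ord"
| "grow (Suc m) es ord =
     (case find_edge es (fst ` set ord) of None \<Rightarrow> ord | Some x \<Rightarrow> grow m es (x # ord))"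

text \<open>\<open>table c items k ! s\<close> is \<open>Some (a, w)\<close> if some of the items at \<open>c\<close> have sum \<open>s\<close>: they get the
  fresh color \<open>Suc c\<close>, and the remaining ones, with sum \<open>a\<close>, are marked 0 in \<open>w\<close>, which means
  that they inherit the color of the edge above \<open>c\<close>.\<close>

fun extend :: "split option list \<Rightarrow> split option list \<Rightarrow> nat \<Rightarrow> edge \<Rightarrow> nat \<Rightarrow> split option list" where
  "extend [] u f e b = []"
| "extend (x # t) u f e b =
     (case x of
        Some (a, w) \<Rightarrow> Some (f + a, (0, e) # w)
      | None \<Rightarrow> (case hd u of Some (a, w) \<Rightarrow> Some (a, (b, e) # w) | None \<Rightarrow> None))
     # extend t (tl u) f e b"

fun table :: "nat \<Rightarrow> item list \<Rightarrow> nat \<Rightarrow> split option list" where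
  "table c [] k = Some (0, []) # replicate k None"
| "table c ((p, f, e) # items) k =
     (let t = table c items k
      in if c = p then extend t (replicate f None @ t) f e (Suc c) else t)"

text \<open>The last entry belongs to the largest attainable sum. Since the total at a vertex is
  fixed, it leaves the smallest inherited part.\<close>

fun pick :: "'a option list \<Rightarrow> 'a option" where
  "pick [] = None"
| "pick (x # t) = (case pick t of None \<Rightarrow> x | Some w \<Rightarrow> Some w)"

fun paint :: "(nat \<times> edge) list \<Rightarrow> nat \<Rightarrow> (edge \<times> nat) list \<Rightarrow> (edge \<times> nat) list" where
  "paint [] g r = r"
| "paint ((b, e) # w) g r = (e, if b = 0 then g else b) # paint w g r"

fun lookup :: "edge \<Rightarrow> (edge \<times> nat) list \<Rightarrow> nat" where
  "lookup e [] = 0"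
| "lookup e ((e', g) # r) = (if e = e' then g else lookup e r)"

text \<open>Failure is the empty list, which is unambiguous because every success contains the pair
  of the dummy edge. The test is \<open>a \<le> k\<close> and not \<open>Suc a \<le> k\<close>
  because the edge above the root does not count; elsewhere, an item of weight \<open>Suc k\<close>
  fits into no fresh group and makes the test fail at the parent. Items are never removed:
  \<open>table\<close> skips those at other vertices.\<close>

fun solve :: "nat \<Rightarrow> vertex_entry list \<Rightarrow> item list \<Rightarrow> (edge \<times> nat) list" where
  "solve k [] items = [((0, 0), 0)]"
| "solve k ((c, p, e) # ord) items =
     (let (a, w) = the (pick (table c items k))
      in if a \<le> k then
           let r = solve k ord ((p, Suc a, e) # items)
           in if r = [] then [] else paint w (lookup e r) r
         else [])"

section \<open>The program and its running time\<close>

abbreviation (input) "main_fn \<equiv> 0 :: nat"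
abbreviation (input) "output_fn \<equiv> 1 :: nat"
abbreviation (input) "eq_fn \<equiv> 2 :: nat"
abbreviation (input) "member_fn \<equiv> 3 :: nat"
abbreviation (input) "find_fn \<equiv> 4 :: nat"
abbreviation (input) "grow_fn \<equiv> 5 :: nat"
abbreviation (input) "append_fn \<equiv> 6 :: nat"
abbreviation (input) "extend_fn \<equiv> 7 :: nat"
abbreviation (input) "table_fn \<equiv> 8 :: nat"
abbreviation (input) "pick_fn \<equiv> 9 :: nat"
abbreviation (input) "le_fn \<equiv> 10 :: nat"
abbreviation (input) "paint_fn \<equiv> 11 :: nat"
abbreviation (input) "lookup_fn \<equiv> 12 :: nat"
abbreviation (input) "solve_fn \<equiv> 13 :: nat"
abbreviation (input) "search_fn \<equiv> 14 :: nat"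

text \<open>The nested \<open>ENil\<close> pairs are the encoded entry of the root, the initial tree
  for \<open>grow\<close>.\<close>

definition "main_body =
   ELet (ECall grow_fn [EHd (EVar 0), ETl (EVar 0),
       ECons (ECons ENil (ECons ENil (ECons ENil ENil))) ENil])
     (ELet (ECall search_fn [EVar 0, ENil])
       (ECons (EHd (EVar 0)) (ECall output_fn [ETl (EVar 2), ETl (EVar 0)])))"

definition "output_body =
   EIf (EVar 0)
     (ECons (ECall lookup_fn [EHd (EVar 0), EVar 1]) (ECall output_fn [ETl (EVar 0), EVar 1]))
     ENil"

definition "eq_body =
   EIf (EVar 0)
     (EIf (EVar 1)
       (EIf (ECall eq_fn [EHd (EVar 0), EHd (EVar 1)]) (ECall eq_fn [ETl (EVar 0), ETl (EVar 1)]) ENil)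
       ENil)
     (EIf (EVar 1) ENil (ECons ENil ENil))"

definition "member_body =
   EIf (EVar 1)
     (EIf (ECall eq_fn [EVar 0, EHd (EHd (EVar 1))]) (ECons ENil ENil)
       (ECall member_fn [EVar 0, ETl (EVar 1)]))
     ENil"

definition "find_body =
   EIf (EVar 0)
     (EIf (ECall member_fn [EHd (EHd (EVar 0)), EVar 1])
       (EIf (ECall member_fn [ETl (EHd (EVar 0)), EVar 1])
         (ECall find_fn [ETl (EVar 0), EVar 1])
         (ECons (ETl (EHd (EVar 0))) (ECons (EHd (EHd (EVar 0))) (EHd (EVar 0)))))
       (EIf (ECall member_fn [ETl (EHd (EVar 0)), EVar 1])
         (ECons (EHd (EHd (EVar 0))) (ECons (ETl (EHd (EVar 0))) (EHd (EVar 0))))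
         (ECall find_fn [ETl (EVar 0), EVar 1])))
     ENil"

definition "grow_body =
   EIf (EVar 0)
     (ELet (ECall find_fn [EVar 1, EVar 2])
       (EIf (EVar 0) (ECall grow_fn [ETl (EVar 1), EVar 2, ECons (EVar 0) (EVar 3)]) (EVar 3)))
     (EVar 2)"

text \<open>One function serves two purposes: a unary number \<open>f\<close> is the same tree as a
  list of \<open>f\<close> copies of \<open>None\<close>, so appending is both addition and shifting
  a table by \<open>f\<close>.\<close>

definition "append_body =
   EIf (EVar 0) (ECons (EHd (EVar 0)) (ECall append_fn [ETl (EVar 0), EVar 1])) (EVar 1)"

definition "extend_body =
   EIf (EVar 0)
     (ECons
       (EIf (EHd (EVar 0))
         (ECons (ECall append_fn [EVar 2, EHd (EHd (EVar 0))])
           (ECons (ECons ENil (EVar 3)) (ETl (EHd (EVar 0)))))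
         (EIf (EHd (EVar 1))
           (ECons (EHd (EHd (EVar 1))) (ECons (ECons (EVar 4) (EVar 3)) (ETl (EHd (EVar 1)))))
           ENil))
       (ECall extend_fn [ETl (EVar 0), ETl (EVar 1), EVar 2, EVar 3, EVar 4]))
     ENil"

definition "table_body =
   EIf (EVar 1)
     (ELet (ECall table_fn [EVar 0, ETl (EVar 1), EVar 2])
       (EIf (ECall eq_fn [EVar 1, EHd (EHd (EVar 2))])
         (ECall extend_fn [EVar 0, ECall append_fn [EHd (ETl (EHd (EVar 2))), EVar 0], EHd (ETl (EHd (EVar 2))),
            ETl (ETl (EHd (EVar 2))), ECons ENil (EVar 1)])
         (EVar 0)))
     (ECons (ECons ENil ENil) (EVar 2))"

definition "pick_body =
   EIf (EVar 0)
     (ELet (ECall pick_fn [ETl (EVar 0)]) (EIf (EVar 0) (EVar 0) (EHd (EVar 1))))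
     ENil"

definition "le_body =
   EIf (EVar 0) (EIf (EVar 1) (ECall le_fn [ETl (EVar 0), ETl (EVar 1)]) ENil) (ECons ENil ENil)"

definition "paint_body =
   EIf (EVar 0)
     (ECons
       (ECons (ETl (EHd (EVar 0))) (EIf (EHd (EHd (EVar 0))) (EHd (EHd (EVar 0))) (EVar 1)))
       (ECall paint_fn [ETl (EVar 0), EVar 1, EVar 2]))
     (EVar 2)"

definition "lookup_body =
   EIf (EVar 1)
     (EIf (ECall eq_fn [EVar 0, EHd (EHd (EVar 1))]) (ETl (EHd (EVar 1)))
       (ECall lookup_fn [EVar 0, ETl (EVar 1)]))
     ENil"

definition "solve_body =
   EIf (EVar 0)
     (ELet (ECall pick_fn [ECall table_fn [EHd (EHd (EVar 0)), EVar 1, EVar 2]])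
       (EIf (ECall le_fn [EHd (EVar 0), EVar 3])
         (ELet (ECall solve_fn [ETl (EVar 1),
              ECons (ECons (EHd (ETl (EHd (EVar 1))))
                (ECons (ECons ENil (EHd (EVar 0))) (ETl (ETl (EHd (EVar 1)))))) (EVar 2),
              EVar 3])
           (EIf (EVar 0)
             (ECall paint_fn [ETl (EVar 1), ECall lookup_fn [ETl (ETl (EHd (EVar 2))), EVar 0], EVar 0])
             ENil))
         ENil))
     (ECons (ECons (ECons ENil ENil) ENil) ENil)"

definition "search_body =
   ELet (ECall solve_fn [EVar 0, ENil, EVar 1])
     (EIf (EVar 0) (ECons (EVar 2) (EVar 0)) (ECall search_fn [EVar 1, ECons ENil (EVar 2)]))"

definition prog :: program where
  "prog = [main_body, output_body, eq_body, member_body, find_body,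
     grow_body, append_body, extend_body, table_body, pick_body,
     le_body, paint_body, lookup_body, solve_body, search_body]"

lemma length_prog [simp]: "length prog = 15"
  by (simp add: prog_def)

lemma wp_call_prog:
  "wp_call prog main_fn vs Q = wp prog vs main_body Q"
  "wp_call prog output_fn vs Q = wp prog vs output_body Q"
  "wp_call prog eq_fn vs Q = wp prog vs eq_body Q"
  "wp_call prog member_fn vs Q = wp prog vs member_body Q"
  "wp_call prog find_fn vs Q = wp prog vs find_body Q"
  "wp_call prog grow_fn vs Q = wp prog vs grow_body Q"
  "wp_call prog append_fn vs Q = wp prog vs append_body Q"
  "wp_call prog extend_fn vs Q = wp prog vs extend_body Q"
  "wp_call prog table_fn vs Q = wp prog vs table_body Q"
  "wp_call prog pick_fn vs Q = wp prog vs pick_body Q"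
  "wp_call prog le_fn vs Q = wp prog vs le_body Q"
  "wp_call prog paint_fn vs Q = wp prog vs paint_body Q"
  "wp_call prog lookup_fn vs Q = wp prog vs lookup_body Q"
  "wp_call prog solve_fn vs Q = wp prog vs solve_body Q"
  "wp_call prog search_fn vs Q = wp prog vs search_body Q"
  unfolding wp_call_def prog_def by simp_all

section \<open>Encodings and step counts\<close>

abbreviation enc_bool :: "bool \<Rightarrow> sexp" where
  "enc_bool b \<equiv> (if b then Node Leaf Leaf else Leaf)"

lemma enc_nat_eq_Leaf [simp]: "enc_nat n = Leaf \<longleftrightarrow> n = 0"
  by (cases n) auto

lemma enc_list_eq_Leaf [simp]: "enc_list f xs = Leaf \<longleftrightarrow> xs = []"
  by (cases xs) auto

lemma enc_pair_neq_Leaf [simp]: "enc_pair f g x \<noteq> Leaf"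
  by (cases x) auto

lemma enc_nat_inject [simp]: "enc_nat m = enc_nat n \<longleftrightarrow> m = n"
proof (induction m arbitrary: n)
  case 0 then show ?case by (cases n) auto
next
  case (Suc m) then show ?case by (cases n) auto
qed

abbreviation enc_edge :: "nat \<times> nat \<Rightarrow> sexp" where
  "enc_edge \<equiv> enc_pair enc_nat enc_nat"

lemma enc_edge_inject [simp]: "enc_edge e = enc_edge e' \<longleftrightarrow> e = e'"
  by (cases e; cases e') auto

lemma size_enc_nat [simp]: "size (enc_nat n) = n"
  by (induction n) auto

text \<open>The comparison descends in both trees at once, so the size of the first alone bounds the
  cost. The constants here and below are generous; only polynomial growth matters.\<close>

lemma calls_eq: "calls prog eq_fn [x, y] (enc_bool (x = y)) (30 * size x + 10)"
proof (induction x arbitrary: y)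
  case Leaf
  show ?case
    by (cases y) (simp_all add: calls_def wp_call_prog eq_body_def)
next
  case (Node x1 x2)
  show ?case
  proof (cases y)
    case Leaf
    then show ?thesis by (simp add: calls_def wp_call_prog eq_body_def)
  next
    case (Node y1 y2)
    show ?thesis
    proof (cases "x1 = y1")
      case True
      show ?thesis
        unfolding calls_def
        apply (subst wp_call_prog)
        apply (simp add: eq_body_def Node split del: if_split)
        apply (rule wp_call_calls[OF Node.IH(1)])
        apply (simp add: True split del: if_split)
        apply (rule wp_call_calls[OF Node.IH(2)])
        apply (simp add: True Node)
        done
    next
      case False
      show ?thesis
        unfolding calls_def
        apply (subst wp_call_prog)
        apply (simp add: eq_body_def Node split del: if_split)
        apply (rule wp_call_calls[OF Node.IH(1)])
        apply (simp add: False Node)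
        done
    qed
  qed
qed

abbreviation enc_entry :: "nat \<times> nat \<times> edge \<Rightarrow> sexp" where
  "enc_entry \<equiv> enc_pair enc_nat (enc_pair enc_nat enc_edge)"

fun enc_option :: "('a \<Rightarrow> sexp) \<Rightarrow> 'a option \<Rightarrow> sexp" where
  "enc_option f None = Leaf"
| "enc_option f (Some x) = f x"

abbreviation enc_split :: "split \<Rightarrow> sexp" where
  "enc_split \<equiv> enc_pair enc_nat (enc_list (enc_pair enc_nat enc_edge))"

abbreviation enc_assoc :: "(edge \<times> nat) list \<Rightarrow> sexp" where
  "enc_assoc \<equiv> enc_list (enc_pair enc_edge enc_nat)"

fun sexp_append :: "sexp \<Rightarrow> sexp \<Rightarrow> sexp" where
  "sexp_append Leaf y = y"
| "sexp_append (Node a b) y = Node a (sexp_append b y)"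

lemma sexp_append_nat [simp]: "sexp_append (enc_nat f) (enc_nat a) = enc_nat (f + a)"
  by (induction f) auto

lemma sexp_append_list [simp]:
  "sexp_append (enc_nat f) (enc_list (enc_option g) t) = enc_list (enc_option g) (replicate f None @ t)"
  by (induction f) auto

lemma length_extend [simp]: "length (extend t u f e b) = length t"
  by (induction t u f e b rule: extend.induct) auto

lemma length_table [simp]: "length (table c items k) = Suc k"
  by (induction c items k rule: table.induct) (auto simp: Let_def)

lemma size_enc_edge: "e \<in> {..m} \<times> {..m} \<Longrightarrow> size (enc_edge e) \<le> 2 * m + 1"
  by (cases e) auto

text \<open>For calls whose arguments have the expected form only after unfolding the
  encodings.\<close>

lemma wp_call_calls':
  assumes "calls P f vs' v T" and "vs = vs'" and "\<And>t. t \<le> T \<Longrightarrow> Q v t"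
  shows "wp_call P f vs Q"
  using assms wp_call_calls by blast

lemma calls_member:
  "calls prog member_fn [enc_nat x, enc_list enc_entry ord] (enc_bool (x \<in> fst ` set ord))
     (length ord * (30 * x + 40) + 10)"
proof (induction ord)
  case Nil
  show ?case by (simp add: calls_def wp_call_prog member_body_def)
next
  case (Cons y ord)
  obtain c p e where y: "y = (c, p, e)" by (cases y)
  show ?case
    unfolding calls_def y
    apply (subst wp_call_prog)
    apply (simp add: member_body_def split del: if_split)
    apply (rule wp_call_calls[OF calls_eq])
    apply (cases "x = c")
     apply simp
    apply (simp split del: if_split)
    apply (rule wp_call_calls[OF Cons.IH])
    apply simp
    done
qed

text \<open>A single parameter \<open>m\<close> that bounds all lengths and numbers involved lets
  the bounds of nested calls compose to a polynomial in \<open>m\<close>.\<close>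

definition "member_time m = m * (30 * m + 40) + 10"

lemma calls_member':
  assumes "x \<le> m" "length ord \<le> m"
  shows "calls prog member_fn [enc_nat x, enc_list enc_entry ord] (enc_bool (x \<in> fst ` set ord))
     (member_time m)"
  by (rule calls_mono[OF calls_member]) (use assms in \<open>auto simp: member_time_def intro!: mult_le_mono\<close>)

lemma calls_find:
  assumes "set es \<subseteq> {..m} \<times> {..m}" "length ord \<le> m"
  shows "calls prog find_fn [enc_list enc_edge es, enc_list enc_entry ord]
     (enc_option enc_entry (find_edge es (fst ` set ord)))
     (length es * (2 * member_time m + 40) + 10)"
  using assms(1)
proof (induction es)
  case Nil
  show ?case by (simp add: calls_def wp_call_prog find_body_def)
next
  case (Cons x es)
  obtain u v where x: "x = (u, v)" by (cases x)
  define S where "S = fst ` set ord"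
  have uv: "u \<le> m" "v \<le> m" using Cons.prems by (auto simp: x)
  note mem = uv[THEN calls_member', OF assms(2), folded S_def]
  have IH: "calls prog find_fn [enc_list enc_edge es, enc_list enc_entry ord]
     (enc_option enc_entry (find_edge es S)) (length es * (2 * member_time m + 40) + 10)"
    using Cons by (auto simp: S_def)
  show ?case
    unfolding calls_def x S_def[symmetric]
    apply (subst wp_call_prog)
    apply (simp add: find_body_def split del: if_split)
    apply (rule wp_call_calls[OF mem(1)])
    apply (cases "u \<in> S"; cases "v \<in> S"; simp)
       apply (rule wp_call_calls[OF mem(2)], simp, rule wp_call_calls[OF IH], simp)
      apply (rule wp_call_calls[OF mem(2)], simp)
     apply (rule wp_call_calls[OF mem(2)], simp)
    apply (rule wp_call_calls[OF mem(2)], simp, rule wp_call_calls[OF IH], simp)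
    done
qed

definition "find_time m = m * (2 * member_time m + 40) + 10"

lemma calls_grow:
  assumes "set es \<subseteq> {..m} \<times> {..m}" "length es \<le> m"
  shows "length ord + n \<le> m \<Longrightarrow>
    calls prog grow_fn [enc_nat n, enc_list enc_edge es, enc_list enc_entry ord]
     (enc_list enc_entry (grow n es ord)) (n * (find_time m + 40) + 10)"
proof (induction n arbitrary: ord)
  case 0
  show ?case by (simp add: calls_def wp_call_prog grow_body_def)
next
  case (Suc n)
  have find: "calls prog find_fn [enc_list enc_edge es, enc_list enc_entry ord]
     (enc_option enc_entry (find_edge es (fst ` set ord))) (find_time m)"
    by (rule calls_mono[OF calls_find[OF assms(1)]]) (use Suc.prems assms(2) in \<open>auto simp: find_time_def\<close>)
  show ?case
  proof (cases "find_edge es (fst ` set ord)")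
    case None
    then show ?thesis
      unfolding calls_def
      apply (subst wp_call_prog)
      apply (simp add: grow_body_def)
      apply (rule wp_call_calls[OF find])
      apply simp
      done
  next
    case (Some x)
    obtain c p e where x: "x = (c, p, e)" by (cases x)
    have IH: "calls prog grow_fn [enc_nat n, enc_list enc_edge es, enc_list enc_entry (x # ord)]
     (enc_list enc_entry (grow n es (x # ord))) (n * (find_time m + 40) + 10)"
      using Suc.IH[of "x # ord"] Suc.prems by simp
    from Some show ?thesis
      unfolding calls_def
      apply (subst wp_call_prog)
      apply (simp add: grow_body_def)
      apply (rule wp_call_calls[OF find])
      apply (simp add: x)
      apply (rule wp_call_calls'[OF IH])
       apply (simp add: x)
      apply (simp add: x)
      done
  qed
qed

lemma calls_append:
  "calls prog append_fn [enc_nat f, y] (sexp_append (enc_nat f) y) (20 * f + 10)"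
proof (induction f)
  case 0
  show ?case by (simp add: calls_def wp_call_prog append_body_def)
next
  case (Suc f)
  show ?case
    unfolding calls_def
    apply (subst wp_call_prog)
    apply (simp add: append_body_def)
    apply (rule wp_call_calls[OF Suc.IH])
    apply simp
    done
qed

lemma calls_extend:
  "length t \<le> length u \<Longrightarrow>
   calls prog extend_fn [enc_list (enc_option enc_split) t, enc_list (enc_option enc_split) u,
       enc_nat f, enc_edge e, enc_nat b]
     (enc_list (enc_option enc_split) (extend t u f e b)) (length t * (20 * f + 80) + 10)"
proof (induction t arbitrary: u)
  case Nil
  show ?case by (simp add: calls_def wp_call_prog extend_body_def)
next
  case (Cons x t)
  then obtain y u' where u: "u = y # u'" by (cases u) auto
  have IH: "calls prog extend_fn [enc_list (enc_option enc_split) t, enc_list (enc_option enc_split) u',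
       enc_nat f, enc_edge e, enc_nat b]
     (enc_list (enc_option enc_split) (extend t u' f e b)) (length t * (20 * f + 80) + 10)"
    using Cons by (simp add: u)
  consider a w where "x = Some (a, w)" | a w where "x = None" "y = Some (a, w)" | "x = None" "y = None"
    by (cases x; cases y) auto
  then show ?case
  proof cases
    case 1
    show ?thesis
      unfolding calls_def u 1
      apply (subst wp_call_prog)
      apply (simp add: extend_body_def)
      apply (rule wp_call_calls[OF calls_append])
      apply simp
      apply (rule wp_call_calls[OF IH])
      apply simp
      done
  next
    case 2
    show ?thesis
      unfolding calls_def u 2
      apply (subst wp_call_prog)
      apply (simp add: extend_body_def)
      apply (rule wp_call_calls[OF IH])
      apply simp
      done
  next
    case 3
    show ?thesis
      unfolding calls_def u 3
      apply (subst wp_call_prog)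
      apply (simp add: extend_body_def)
      apply (rule wp_call_calls[OF IH])
      apply simp
      done
  qed
qed

definition "extend_time m = m * (20 * m + 80) + 10"

lemma calls_table:
  assumes "c \<le> m" "Suc k \<le> m"
  shows "\<forall>(p, f, e) \<in> set items. f \<le> m \<Longrightarrow>
    calls prog table_fn [enc_nat c, enc_list enc_entry items, enc_nat k]
     (enc_list (enc_option enc_split) (table c items k)) (length items * (extend_time m + 50 * m + 100) + 10)"
proof (induction items)
  case Nil
  \<comment> \<open>The program uses the number \<open>k\<close> itself as the tail of the initial
    table.\<close>
  have "enc_nat k = enc_list (enc_option enc_split) (replicate k None)"
    by (induction k) auto
  then show ?case by (simp add: calls_def wp_call_prog table_body_def)
next
  case (Cons x items)
  obtain p f e where x: "x = (p, f, e)" by (cases x)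
  define t where "t = table c items k"
  have IH: "calls prog table_fn [enc_nat c, enc_list enc_entry items, enc_nat k]
     (enc_list (enc_option enc_split) t) (length items * (extend_time m + 50 * m + 100) + 10)"
    using Cons by (auto simp: t_def)
  have f: "f \<le> m" using Cons.prems by (simp add: x)
  have "length t \<le> m" using assms(2) by (simp add: t_def)
  with f have "length t * (20 * f + 80) + 10 \<le> extend_time m"
    by (auto simp: extend_time_def intro!: mult_le_mono)
  then have ext: "calls prog extend_fn
      [enc_list (enc_option enc_split) t, enc_list (enc_option enc_split) (replicate f None @ t),
       enc_nat f, enc_edge e, enc_nat (Suc c)]
     (enc_list (enc_option enc_split) (extend t (replicate f None @ t) f e (Suc c))) (extend_time m)"
    by (intro calls_mono[OF calls_extend]) auto
  show ?case
  proof (cases "c = p")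
    case True
    show ?thesis
      unfolding calls_def x
      apply (subst wp_call_prog)
      apply (simp add: table_body_def)
      apply (rule wp_call_calls[OF IH])
      apply simp
      apply (rule wp_call_calls[OF calls_eq])
      apply (simp add: True)
      apply (rule wp_call_calls[OF calls_append])
      apply simp
      apply (rule wp_call_calls'[OF ext])
      using assms f apply (simp_all add: t_def True Let_def)
      done
  next
    case False
    show ?thesis
      unfolding calls_def x
      apply (subst wp_call_prog)
      apply (simp add: table_body_def)
      apply (rule wp_call_calls[OF IH])
      apply simp
      apply (rule wp_call_calls[OF calls_eq])
      using assms apply (simp add: False t_def)
      done
  qed
qed

lemma enc_option_inj_Leaf:
  "enc_option enc_split x = Leaf \<longleftrightarrow> x = None"
  by (cases x) auto

lemma calls_pick:
  "calls prog pick_fn [enc_list (enc_option enc_split) t] (enc_option enc_split (pick t))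
     (20 * length t + 10)"
proof (induction t)
  case Nil
  show ?case by (simp add: calls_def wp_call_prog pick_body_def)
next
  case (Cons x t)
  show ?case
    unfolding calls_def
    apply (subst wp_call_prog)
    apply (simp add: pick_body_def)
    apply (rule wp_call_calls[OF Cons.IH])
    apply (cases "pick t")
     apply (simp_all add: enc_option_inj_Leaf)
    done
qed

lemma calls_le: "calls prog le_fn [enc_nat x, enc_nat y] (enc_bool (x \<le> y)) (20 * y + 20)"
proof (induction x arbitrary: y)
  case 0
  show ?case by (simp add: calls_def wp_call_prog le_body_def)
next
  case (Suc x)
  show ?case
  proof (cases y)
    case 0
    then show ?thesis by (simp add: calls_def wp_call_prog le_body_def)
  next
    case (Suc y')
    show ?thesis
      unfolding calls_def Suc
      apply (subst wp_call_prog)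
      apply (simp add: le_body_def split del: if_split)
      apply (rule wp_call_calls[OF Suc.IH])
      apply simp
      done
  qed
qed

lemma calls_paint:
  "calls prog paint_fn [enc_list (enc_pair enc_nat enc_edge) w, enc_nat g, enc_assoc r]
     (enc_assoc (paint w g r)) (40 * length w + 10)"
proof (induction w)
  case Nil
  show ?case by (simp add: calls_def wp_call_prog paint_body_def)
next
  case (Cons x w)
  obtain b e where x: "x = (b, e)" by (cases x)
  show ?case
    unfolding calls_def x
    apply (subst wp_call_prog)
    apply (simp add: paint_body_def)
    apply (cases "b = 0"; simp)
     apply (rule wp_call_calls[OF Cons.IH], simp)+
    done
qed

lemma calls_lookup:
  "calls prog lookup_fn [enc_edge e, enc_assoc r] (enc_nat (lookup e r))
     (length r * (30 * size (enc_edge e) + 40) + 10)"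
proof (induction r)
  case Nil
  show ?case by (simp add: calls_def wp_call_prog lookup_body_def)
next
  case (Cons x r)
  obtain e' g where x: "x = (e', g)" by (cases x)
  show ?case
    unfolding calls_def x
    apply (subst wp_call_prog)
    apply (simp add: lookup_body_def)
    apply (rule wp_call_calls[OF calls_eq])
    apply (cases "e = e'")
     apply simp
    apply simp
    apply (rule wp_call_calls[OF Cons.IH])
    apply simp
    done
qed

text \<open>An encoded edge has size at most \<open>2 * m + 1\<close>, and
  \<open>30 * (2 * m + 1) + 40 = 60 * m + 70\<close>.\<close>

definition "lookup_time l m = l * (60 * m + 70) + 10"

lemma calls_lookup':
  assumes "e \<in> {..m} \<times> {..m}" "length r \<le> l"
  shows "calls prog lookup_fn [enc_edge e, enc_assoc r] (enc_nat (lookup e r)) (lookup_time l m)"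
  by (rule calls_mono[OF calls_lookup])
     (use assms size_enc_edge[OF assms(1)] in \<open>auto simp: lookup_time_def simp del: mem_Sigma_iff intro!: mult_le_mono\<close>)

lemma calls_output:
  assumes "length r \<le> l"
  shows "set es \<subseteq> {..m} \<times> {..m} \<Longrightarrow>
   calls prog output_fn [enc_list enc_edge es, enc_assoc r]
     (enc_list enc_nat (map (\<lambda>e. lookup e r) es)) (length es * (lookup_time l m + 40) + 10)"
proof (induction es)
  case Nil
  show ?case unfolding calls_def wp_call_prog by (simp add: output_body_def)
next
  case (Cons e es)
  have lk: "calls prog lookup_fn [enc_edge e, enc_assoc r] (enc_nat (lookup e r)) (lookup_time l m)"
    using Cons.prems assms by (intro calls_lookup') auto
  have IH: "calls prog output_fn [enc_list enc_edge es, enc_assoc r]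
     (enc_list enc_nat (map (\<lambda>e. lookup e r) es)) (length es * (lookup_time l m + 40) + 10)"
    using Cons by simp
  show ?case
    unfolding calls_def
    apply (subst wp_call_prog)
    apply (simp add: output_body_def)
    apply (rule wp_call_calls[OF lk])
    apply simp
    apply (rule wp_call_calls[OF IH[simplified]])
    apply simp
    done
qed

lemma pick_eq_None: "pick t = None \<longleftrightarrow> set t \<subseteq> {None}"
  by (induction t) (auto split: option.splits)

lemma length_split_extend:
  assumes "\<forall>(a, w) \<in> Option.these (set t). length w \<le> n" "\<forall>(a, w) \<in> Option.these (set u). length w \<le> n"
    "length t \<le> length u"
  shows "\<forall>(a, w) \<in> Option.these (set (extend t u f e b)). length w \<le> Suc n"
  using assms
proof (induction t arbitrary: u)
  case (Cons x t)
  then obtain y u' where u: "u = y # u'" by (cases u) auto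
  show ?case using Cons.IH[of u'] Cons.prems
    by (auto simp: u in_these_eq split: option.splits)
qed auto

text \<open>A split carries at most one mark per item; this bounds the cost of \<open>paint\<close>
  and the growth of the result of \<open>solve\<close>.\<close>

lemma length_split_table:
  "\<forall>(a, w) \<in> Option.these (set (table c items k)). length w \<le> length items"
proof (induction items)
  case (Cons x items)
  obtain p f e where x: "x = (p, f, e)" by (cases x)
  have "\<forall>(a, w) \<in> Option.these (set (extend (table c items k) (replicate f None @ table c items k) f e (Suc c))).
     length w \<le> Suc (length items)"
    by (rule length_split_extend) (use Cons in \<open>auto simp: in_these_eq\<close>)
  with Cons show ?case by (auto simp: x Let_def)
qed (auto simp: in_these_eq)

text \<open>The empty subset has sum 0, so the entry at index 0 is always present. Hence
  \<open>pick\<close> succeeds on every table and \<open>the\<close> in \<open>solve\<close> never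
  meets \<open>None\<close>.\<close>

lemma table_neq_None: "\<exists>x t. table c items k = Some x # t"
proof (induction items)
  case (Cons x items)
  then obtain y t where "table c items k = Some y # t" by blast
  then show ?case by (cases x; cases y) (auto simp: Let_def)
qed auto

lemma pick_mem: "pick t = Some x \<Longrightarrow> Some x \<in> set t"
  by (induction t) (auto split: option.splits)

lemma pick_table:
  obtains a w where "pick (table c items k) = Some (a, w)"
    "Some (a, w) \<in> set (table c items k)" "length w \<le> length items"
proof -
  have "pick (table c items k) \<noteq> None"
    using table_neq_None[of c items k] by (auto simp: pick_eq_None)
  then obtain a w where aw: "pick (table c items k) = Some (a, w)" by auto
  with length_split_table[of c items k] show thesis
    by (intro that[OF aw]) (auto dest!: pick_mem simp: in_these_eq)
qed

lemma length_paint [simp]: "length (paint w g r) = length w + length r"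
  by (induction w g r rule: paint.induct) auto

text \<open>Each level paints at most the items present, and every earlier level has added just one.
  The quadratic bound is needed because \<open>lookup\<close> scans the result.\<close>

lemma length_solve:
  "length (solve k ord items) \<le> 1 + length ord * (length ord + length items)"
proof (induction ord arbitrary: items)
  case (Cons x ord)
  obtain c p e where x: "x = (c, p, e)" by (cases x)
  obtain a w where aw: "pick (table c items k) = Some (a, w)" "length w \<le> length items"
    using pick_table by metis
  show ?case
    using Cons.IH[of "(p, Suc a, e) # items"] aw
    by (auto simp: x Let_def)
qed auto

definition "solve_time m = m * (m * (extend_time m + 50 * m + 100) + lookup_time (1 + m * m) m + 200 * m + 200) + 10"

lemma calls_solve:
  assumes "Suc k \<le> m" and "\<forall>(c, p, e) \<in> set ord. c \<le> m \<and> e \<in> {..m} \<times> {..m}"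
    and "\<forall>(p, f, e) \<in> set items. f \<le> m" and "length ord + length items \<le> m"
  shows "calls prog solve_fn [enc_list enc_entry ord, enc_list enc_entry items, enc_nat k]
     (enc_assoc (solve k ord items))
     (length ord * (m * (extend_time m + 50 * m + 100) + lookup_time (1 + m * m) m + 200 * m + 200) + 10)"
  using assms(2-)
proof (induction ord arbitrary: items)
  case Nil
  show ?case by (simp add: calls_def wp_call_prog solve_body_def)
next
  case (Cons x ord)
  obtain c p e where x: "x = (c, p, e)" by (cases x)
  obtain a w where aw: "pick (table c items k) = Some (a, w)" "length w \<le> length items"
    using pick_table by metis
  define L where "L = lookup_time (1 + m * m) m"
  have tab: "calls prog table_fn [enc_nat c, enc_list enc_entry items, enc_nat k]
     (enc_list (enc_option enc_split) (table c items k)) (m * (extend_time m + 50 * m + 100) + 10)"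
    by (rule calls_mono[OF calls_table[where m = m]]) (use Cons.prems assms(1) in \<open>auto simp: x intro!: mult_le_mono\<close>)
  define tt where "tt = m * (extend_time m + 50 * m + 100)"
  note tab = tab[folded tt_def]
  note pick = calls_pick[of "table c items k", unfolded aw(1) length_table, simplified]
  show ?case
  proof (cases "a \<le> k")
    case False
    show ?thesis
      unfolding calls_def x
      apply (subst wp_call_prog)
      apply (simp add: solve_body_def)
      apply (rule wp_call_calls[OF tab])
      apply simp
      apply (rule wp_call_calls[OF pick])
      apply simp
      apply (rule wp_call_calls[OF calls_le])
      using assms(1) apply (simp add: False aw(1) tt_def)
      done
  next
    case True
    define r where "r = solve k ord ((p, Suc a, e) # items)"
    have IH: "calls prog solve_fn
        [enc_list enc_entry ord, enc_list enc_entry ((p, Suc a, e) # items), enc_nat k]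
        (enc_assoc r) (length ord * (tt + L + 200 * m + 200) + 10)"
      unfolding r_def tt_def L_def
      by (rule Cons.IH) (use Cons.prems True assms(1) in auto)
    have "length r \<le> 1 + length ord * (length ord + length ((p, Suc a, e) # items))"
      unfolding r_def by (rule length_solve)
    also have "\<dots> \<le> 1 + m * m"
      using Cons.prems(3) by (intro add_left_mono mult_le_mono) auto
    finally have lk: "calls prog lookup_fn [enc_edge e, enc_assoc r] (enc_nat (lookup e r)) L"
      unfolding L_def using Cons.prems(1) by (intro calls_lookup') (auto simp: x)
    have solve: "solve k ((c, p, e) # ord) items = (if r = [] then [] else paint w (lookup e r) r)"
      using aw(1) True by (simp add: r_def Let_def)
    have m: "length w \<le> m" using aw(2) Cons.prems(3) by simp
    show ?thesis
      unfolding calls_def x solve L_def[symmetric] tt_def[symmetric]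
      apply (subst wp_call_prog)
      apply (simp add: solve_body_def split del: if_split)
      apply (rule wp_call_calls[OF tab])
      apply (simp split del: if_split)
      apply (rule wp_call_calls[OF pick])
      apply (simp split del: if_split)
      apply (rule wp_call_calls[OF calls_le])
      apply (simp add: True split del: if_split)
      apply (rule wp_call_calls'[OF IH])
       apply simp
      apply (cases "r = []"; simp)
      using assms(1) apply simp
      apply (rule wp_call_calls[OF lk])
      apply simp
      apply (rule wp_call_calls[OF calls_paint])
      using assms(1) m apply simp
      done
  qed
qed

lemma calls_search:
  assumes "Suc K \<le> m" and "\<forall>(c, p, e) \<in> set ord. c \<le> m \<and> e \<in> {..m} \<times> {..m}"
    and "length ord \<le> m" and "solve K ord [] \<noteq> []"
  shows "k \<le> K \<Longrightarrow> \<forall>j < K. solve j ord [] = [] \<Longrightarrow>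
    calls prog search_fn [enc_list enc_entry ord, enc_nat k]
     (Node (enc_nat K) (enc_assoc (solve K ord []))) (Suc (K - k) * (solve_time m + 40))"
proof (induction "K - k" arbitrary: k)
  case 0
  then have k: "k = K" by simp
  have sol: "calls prog solve_fn [enc_list enc_entry ord, Leaf, enc_nat k] (enc_assoc (solve k ord [])) (solve_time m)"
    by (rule calls_mono[OF calls_solve[where m = m and items = "[]", simplified enc_list.simps]])
      (use assms k in \<open>auto simp: solve_time_def intro!: mult_le_mono\<close>)
  show ?case
    unfolding calls_def
    apply (subst wp_call_prog)
    apply (simp add: search_body_def)
    apply (rule wp_call_calls[OF sol])
    apply (simp add: k assms)
    done
next
  case (Suc d)
  then have k: "k < K" "solve k ord [] = []" "d = K - Suc k" by simp_all
  have sol: "calls prog solve_fn [enc_list enc_entry ord, Leaf, enc_nat k] (enc_assoc (solve k ord [])) (solve_time m)"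
    by (rule calls_mono[OF calls_solve[where m = m and items = "[]", simplified enc_list.simps]])
      (use assms k in \<open>auto simp: solve_time_def intro!: mult_le_mono\<close>)
  have IH: "calls prog search_fn [enc_list enc_entry ord, enc_nat (Suc k)]
     (Node (enc_nat K) (enc_assoc (solve K ord []))) (Suc d * (solve_time m + 40))"
    using Suc.hyps(1)[of "Suc k"] Suc.prems k by simp
  show ?case
    unfolding calls_def Suc.hyps(2)[symmetric]
    apply (subst wp_call_prog)
    apply (simp add: search_body_def)
    apply (rule wp_call_calls[OF sol])
    apply (simp add: k)
    apply (rule wp_call_calls'[OF IH])
     apply simp
    apply simp
    done
qed

section \<open>Correctness on rooted trees\<close>

fun entry_edge :: "nat \<times> nat \<times> edge \<Rightarrow> edge" where
  "entry_edge (c, p, e) = e"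

section \<open>Subset sums of items\<close>

definition wsum :: "(nat \<Rightarrow> edge \<Rightarrow> bool) \<Rightarrow> item list \<Rightarrow> nat" where
  "wsum Q items = (\<Sum>(p, f, e)\<leftarrow>items. if Q p e then f else 0)"

lemma wsum_simps [simp]:
  "wsum Q [] = 0"
  "wsum Q ((p, f, e) # items) = (if Q p e then f else 0) + wsum Q items"
  by (simp_all add: wsum_def)

lemma wsum_mono:
  "(\<And>p f e. (p, f, e) \<in> set items \<Longrightarrow> Q p e \<Longrightarrow> Q' p e) \<Longrightarrow> wsum Q items \<le> wsum Q' items"
  by (auto simp: wsum_def intro!: sum_list_mono)

lemma wsum_cong:
  "(\<And>p f e. (p, f, e) \<in> set items \<Longrightarrow> Q p e = Q' p e) \<Longrightarrow> wsum Q items = wsum Q' items"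
  by (intro antisym wsum_mono) auto

lemma wsum_split:
  "wsum Q items = wsum (\<lambda>p e. Q p e \<and> R p e) items + wsum (\<lambda>p e. Q p e \<and> \<not> R p e) items"
  by (induction items) auto

lemma wsum_False: "(\<And>p f e. (p, f, e) \<in> set items \<Longrightarrow> \<not> Q p e) \<Longrightarrow> wsum Q items = 0"
  by (induction items) fastforce+

lemma nth_extend:
  "i < length t \<Longrightarrow> length t \<le> length u \<Longrightarrow>
   extend t u f e b ! i =
     (case t ! i of
        Some (a, w) \<Rightarrow> Some (f + a, (0, e) # w)
      | None \<Rightarrow> (case u ! i of Some (a, w) \<Rightarrow> Some (a, (b, e) # w) | None \<Rightarrow> None))"
proof (induction t u f e b arbitrary: i rule: extend.induct)
  case (2 x t u f e b)
  then obtain y u' where u: "u = y # u'" by (cases u) auto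
  show ?case
  proof (cases i)
    case 0
    then show ?thesis by (auto simp: u split: option.split)
  next
    case (Suc j)
    then show ?thesis using 2 by (auto simp: u split: option.split)
  qed
qed auto

text \<open>A subset avoiding the new item is found at the same index of the old table, one
  containing it at the index lowered by \<open>f\<close>, which is what the shifted copy
  provides.\<close>

lemma table_complete:
  "wsum (\<lambda>p e. p = c \<and> Q e) items \<le> k \<Longrightarrow> table c items k ! wsum (\<lambda>p e. p = c \<and> Q e) items \<noteq> None"
proof (induction items)
  case (Cons x items)
  obtain p f e where x: "x = (p, f, e)" by (cases x)
  define s where "s = wsum (\<lambda>p e. p = c \<and> Q e) items"
  define t where "t = table c items k"
  have len: "length t = Suc k" by (simp add: t_def)
  have s: "s \<le> k" "t ! s \<noteq> None"
    using Cons by (simp_all add: x s_def t_def)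
  show ?case
  proof (cases "p = c")
    case True
    have "(if Q e then f else 0) + s \<le> k" using Cons.prems by (simp add: x True s_def)
    with s show ?thesis
      by (auto simp: x True Let_def s_def[symmetric] t_def[symmetric] nth_extend len nth_append split: option.splits)
  qed (use s in \<open>auto simp: x s_def t_def Let_def\<close>)
qed auto

text \<open>The table keeps one subset per sum. This loses nothing: the total weight at
  \<open>c\<close> is fixed, so \<open>s\<close> determines \<open>a\<close>, whichever subset is
  kept.\<close>

lemma table_sound:
  "distinct (map entry_edge items) \<Longrightarrow> s \<le> k \<Longrightarrow> table c items k ! s = Some (a, w) \<Longrightarrow>
   \<exists>Q. s = wsum (\<lambda>p e. p = c \<and> Q e) items \<and> a = wsum (\<lambda>p e. p = c \<and> \<not> Q e) items \<and>
       w = map (\<lambda>(p, f, e). (if Q e then Suc c else 0, e)) (filter (\<lambda>(p, f, e). p = c) items)"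
proof (induction items arbitrary: s a w)
  case Nil
  then show ?case by (cases s) auto
next
  case (Cons x items)
  obtain p f e where x: "x = (p, f, e)" by (cases x)
  define t where "t = table c items k"
  have len: "length t = Suc k" by (simp add: t_def)
  have new: "\<And>q g. (q, g, e) \<notin> set items" using Cons.prems(1) by (force simp: x)
  show ?case
  proof (cases "p = c")
    case False
    with Cons show ?thesis by (auto simp: x Let_def)
  next
    case True
    have step: "\<exists>Q. s = wsum (\<lambda>p e. p = c \<and> Q e) (x # items) \<and>
        a = wsum (\<lambda>p e. p = c \<and> \<not> Q e) (x # items) \<and>
        w = map (\<lambda>(p, f, e). (if Q e then Suc c else 0, e)) (filter (\<lambda>(p, f, e). p = c) (x # items))"
      if tab: "t ! s' = Some (a', w')" and s': "s' \<le> k" "s = (if b then f else 0) + s'"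
        and aw: "a = (if b then 0 else f) + a'" "w = (if b then Suc c else 0, e) # w'" for b s' a' w'
    proof -
      obtain Q where Q: "s' = wsum (\<lambda>p e. p = c \<and> Q e) items" "a' = wsum (\<lambda>p e. p = c \<and> \<not> Q e) items"
        "w' = map (\<lambda>(p, f, e). (if Q e then Suc c else 0, e)) (filter (\<lambda>(p, f, e). p = c) items)"
        using Cons.IH[OF _ s'(1) tab[unfolded t_def]] Cons.prems(1) by (simp, blast)
      \<comment> \<open>\<open>b\<close> tells whether the new item gets the fresh color. Its edge
        occurs in no other item, so updating \<open>Q\<close> at \<open>e\<close> leaves the old
        sums alone.\<close>
      have "wsum (\<lambda>p e'. p = c \<and> (Q(e := b)) e') items = s'"
        "wsum (\<lambda>p e'. p = c \<and> \<not> (Q(e := b)) e') items = a'"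
        unfolding Q by (rule wsum_cong, use new in auto)+
      then show ?thesis
        using s' aw new by (intro exI[of _ "Q(e := b)"]) (auto simp: x True Q(3))
    qed
    have ext: "extend t (replicate f None @ t) f e (Suc c) ! s = Some (a, w)"
      using Cons.prems(3) by (simp add: x True t_def Let_def)
    show ?thesis
    proof (cases "t ! s")
      case (Some aw)
      then show ?thesis
        using ext Cons.prems(2) by (intro step[of s "fst aw" "snd aw" False]) (auto simp: nth_extend len split: prod.splits)
    next
      case None
      with ext Cons.prems(2) obtain w' where "f \<le> s" "t ! (s - f) = Some (a, w')" "w = (Suc c, e) # w'"
        by (auto simp: nth_extend len nth_append split: option.splits if_splits)
      then show ?thesis
        using Cons.prems(2) by (intro step[of "s - f" a w' True]) auto
    qed
  qed
qed

lemma pick_last: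
  "pick t = Some x \<Longrightarrow> \<exists>s < length t. t ! s = Some x \<and> (\<forall>s'. s < s' \<and> s' < length t \<longrightarrow> t ! s' = None)"
proof (induction t)
  case (Cons y t)
  show ?case
  proof (cases "pick t")
    case None
    then have "\<forall>i < length t. t ! i = None" by (auto simp: pick_eq_None subset_iff)
    with None Cons.prems show ?thesis by (intro exI[of _ 0]) (auto simp: nth_Cons split: nat.splits)
  next
    case (Some z)
    with Cons obtain s where "s < length t" "t ! s = Some x" "\<forall>s'. s < s' \<and> s' < length t \<longrightarrow> t ! s' = None"
      by auto
    then show ?thesis by (intro exI[of _ "Suc s"]) (auto simp: nth_Cons split: nat.splits)
  qed
qed auto

text \<open>Every admissible \<open>R\<close> has an attainable sum, hence one not above the sum
  that \<open>pick\<close> selects; passing to complements within the fixed total turns this maximum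
  into the minimum of the inherited part.\<close>

lemma best_split:
  assumes "distinct (map entry_edge items)"
  obtains Q where
    "the (pick (table c items k)) =
       (wsum (\<lambda>p e. p = c \<and> \<not> Q e) items,
        map (\<lambda>(p, f, e). (if Q e then Suc c else 0, e)) (filter (\<lambda>(p, f, e). p = c) items))"
    and "wsum (\<lambda>p e. p = c \<and> Q e) items \<le> k"
    and "\<And>R. wsum (\<lambda>p e. p = c \<and> R e) items \<le> k \<Longrightarrow>
       wsum (\<lambda>p e. p = c \<and> \<not> Q e) items \<le> wsum (\<lambda>p e. p = c \<and> \<not> R e) items"
proof -
  obtain a w where aw: "pick (table c items k) = Some (a, w)"
    using pick_table by metis
  from pick_last[OF this] obtain s where s: "s \<le> k" "table c items k ! s = Some (a, w)"
    "\<And>s'. s < s' \<Longrightarrow> s' \<le> k \<Longrightarrow> table c items k ! s' = None"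
    by (auto simp: less_Suc_eq_le)
  obtain Q where Q: "s = wsum (\<lambda>p e. p = c \<and> Q e) items" "a = wsum (\<lambda>p e. p = c \<and> \<not> Q e) items"
    "w = map (\<lambda>(p, f, e). (if Q e then Suc c else 0, e)) (filter (\<lambda>(p, f, e). p = c) items)"
    using table_sound[OF assms s(1,2)] by blast
  show thesis
  proof (rule that[of Q])
    fix R assume R: "wsum (\<lambda>p e. p = c \<and> R e) items \<le> k"
    have "wsum (\<lambda>p e. p = c \<and> R e) items \<le> s"
      using s(3)[OF _ R] table_complete[OF R] by (meson not_le)
    then show "wsum (\<lambda>p e. p = c \<and> \<not> Q e) items \<le> wsum (\<lambda>p e. p = c \<and> \<not> R e) items"
      using wsum_split[of "\<lambda>p e. p = c" items "\<lambda>p. Q"] wsum_split[of "\<lambda>p e. p = c" items "\<lambda>p. R"]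
      by (simp add: Q)
  qed (use aw Q s(1) in auto)
qed

section \<open>Rooted trees and the potential\<close>

inductive tree_order :: "vertex_entry list \<Rightarrow> bool" where
  root: "tree_order [(0, 0, 0, 0)]"
| step: "tree_order ord \<Longrightarrow> c \<notin> fst ` set ord \<Longrightarrow> p \<in> fst ` set ord \<Longrightarrow> e = (c, p) \<or> e = (p, c)
    \<Longrightarrow> tree_order ((c, p, e) # ord)"

lemma tree_order_endpoints:
  "tree_order ord \<Longrightarrow> (c, p, u, v) \<in> set ord \<Longrightarrow>
    p \<in> fst ` set ord \<and> u \<in> fst ` set ord \<and> v \<in> fst ` set ord"
proof (induction arbitrary: c p u v rule: tree_order.induct)
  case (step ord c' p' e')
  then show ?case using step.IH[of c p u v] by (cases "(c, p, u, v) \<in> set ord") auto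
qed auto

text \<open>The edge of a new entry contains the new vertex, which is not an endpoint of any earlier
  edge.\<close>

lemma tree_order_distinct:
  "tree_order ord \<Longrightarrow> distinct (map fst ord) \<and> distinct (map entry_edge ord)"
proof (induction rule: tree_order.induct)
  case (step ord c p e)
  have "e \<notin> entry_edge ` set ord"
    using step.hyps tree_order_endpoints[OF step.hyps(1)] by force
  with step show ?case by auto
qed auto

lemma paint_eq_Nil [simp]: "paint w g r = [] \<longleftrightarrow> w = [] \<and> r = []"
  by (cases "(w, g, r)" rule: paint.cases) auto

text \<open>The part of color \<open>d\<close> that still matters: the items at unprocessed vertices, and the edges
  above these vertices.\<close>

definition load :: "(edge \<Rightarrow> 'c) \<Rightarrow> 'c \<Rightarrow> vertex_entry list \<Rightarrow> item list \<Rightarrow> nat" where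
  "load \<chi> d ord items =
     wsum (\<lambda>p e. p \<in> fst ` set ord \<and> \<chi> e = d) items +
     length (filter (\<lambda>(c, p, e). e \<noteq> (0, 0) \<and> \<chi> e = d) ord)"

lemma load_Nil [simp]: "load \<chi> d [] items = 0"
  by (auto simp: load_def intro: wsum_False)

lemma load_Cons:
  assumes "c \<notin> fst ` set ord"
  shows "load \<chi> d ((c, p, e) # ord) items =
    wsum (\<lambda>q e. q = c \<and> \<chi> e = d) items + (if e \<noteq> (0, 0) \<and> \<chi> e = d then 1 else 0) + load \<chi> d ord items"
proof -
  have "wsum (\<lambda>q e. q \<in> fst ` set ((c, p, e) # ord) \<and> \<chi> e = d) items =
    wsum (\<lambda>q e. q = c \<and> \<chi> e = d) items + wsum (\<lambda>q e. q \<in> fst ` set ord \<and> \<chi> e = d) items"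
    unfolding wsum_split[of "\<lambda>q e. q \<in> fst ` set ((c, p, e) # ord) \<and> \<chi> e = d" items "\<lambda>q e. q = c"]
    by (intro arg_cong2[of _ _ _ _ "(+)"] wsum_cong) (use assms in auto)
  then show ?thesis by (simp add: load_def)
qed

lemma load_item:
  "load \<chi> d ord ((p, f, e) # items) =
     (if p \<in> fst ` set ord \<and> \<chi> e = d then f else 0) + load \<chi> d ord items"
  by (simp add: load_def)

text \<open>The edges from \<open>c\<close> down to its children, processed (items) or not
  (entries). The edge above \<open>c\<close> is left out, being the one whose color is compared with
  theirs; only at the root is it included, because the root's entry names 0 as its own
  parent.\<close>

definition incident :: "vertex_entry list \<Rightarrow> item list \<Rightarrow> nat \<Rightarrow> edge set" where
  "incident ord items c = {e. (\<exists>f. (c, f, e) \<in> set items) \<or> (\<exists>c'. (c', c, e) \<in> set ord)}"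

text \<open>The items at \<open>c\<close> not colored \<gamma> all have color \<open>d\<close>, so
  they weigh at most \<open>k\<close> together and are one of the subsets among which the algorithm
  chose the best.\<close>

lemma split_le:
  assumes dist: "distinct (map entry_edge items)"
    and col: "\<forall>e' \<in> incident ord items c. \<chi> e' \<in> {\<gamma>, d}"
    and le: "\<And>d. wsum (\<lambda>q e. q = c \<and> \<chi> e = d) items \<le> k"
  shows "fst (the (pick (table c items k))) \<le> wsum (\<lambda>q e. q = c \<and> \<chi> e = \<gamma>) items"
proof -
  obtain Q where Q: "fst (the (pick (table c items k))) = wsum (\<lambda>p e. p = c \<and> \<not> Q e) items"
    "\<And>R. wsum (\<lambda>p e. p = c \<and> R e) items \<le> k \<Longrightarrow>
       wsum (\<lambda>p e. p = c \<and> \<not> Q e) items \<le> wsum (\<lambda>p e. p = c \<and> \<not> R e) items"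
    by (rule best_split[OF dist, of c k]) simp
  have "wsum (\<lambda>p e. p = c \<and> \<chi> e \<noteq> \<gamma>) items \<le> wsum (\<lambda>q e. q = c \<and> \<chi> e = d) items"
    by (rule wsum_mono) (use col in \<open>force simp: incident_def\<close>)
  also note le
  finally show ?thesis using Q(2)[of "\<lambda>e. \<chi> e \<noteq> \<gamma>"] Q(1) by simp
qed

text \<open>Here \<chi> is arbitrary, while the weights are the algorithm's. Removing the leaf
  \<open>c\<close> takes its items of color \<open>\<chi> e\<close> and the edge \<open>e\<close>
  out of the load of that color and adds one item of weight \<open>Suc a\<close>, which by
  \<open>split_le\<close> is not heavier. No other load increases, so the bound \<open>k\<close>
  persists up to the root.\<close>

lemma solve_complete:
  assumes "tree_order ord" and "distinct (map entry_edge items @ map entry_edge ord)"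
    and "\<forall>(c, p, e) \<in> set ord. \<exists>d. \<forall>e' \<in> incident ord items c. \<chi> e' \<in> {\<chi> e, d}"
    and "\<And>d. load \<chi> d ord items \<le> k"
  shows "solve k ord items \<noteq> []"
  using assms
proof (induction arbitrary: items rule: tree_order.induct)
  case root
  then obtain d where d: "\<forall>e' \<in> incident [(0, 0, 0, 0)] items 0. \<chi> e' \<in> {\<chi> (0, 0), d}" by auto
  obtain a w where aw: "the (pick (table 0 items k)) = (a, w)" by (metis surj_pair)
  have le: "wsum (\<lambda>q e. q = 0 \<and> \<chi> e = d) items \<le> k" for d
    using root(3)[of d] by (simp add: load_Cons)
  have "a \<le> wsum (\<lambda>q e. q = 0 \<and> \<chi> e = \<chi> (0, 0)) items"
    using split_le[OF _ d le] root(1) aw by simp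
  also note le
  finally have "a \<le> k" .
  then show ?case by (simp add: aw Let_def)
next
  case (step ord c p e)
  obtain d where d: "\<forall>e' \<in> incident ((c, p, e) # ord) items c. \<chi> e' \<in> {\<chi> e, d}"
    using step.prems(2) by auto
  obtain a w where aw: "the (pick (table c items k)) = (a, w)" by (metis surj_pair)
  have le: "wsum (\<lambda>q e. q = c \<and> \<chi> e = d) items \<le> k" for d
    using step.prems(3)[of d] step.hyps by (simp add: load_Cons)
  have a: "a \<le> wsum (\<lambda>q e'. q = c \<and> \<chi> e' = \<chi> e) items"
    using split_le[OF _ d le] step.prems(1) aw by simp
  also note le
  finally have ak: "a \<le> k" .
  have e: "e \<noteq> (0, 0)" using step.hyps by auto
  define items' where "items' = (p, Suc a, e) # items"
  have inc: "incident ord items' x \<subseteq> incident ((c, p, e) # ord) items x" for x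
    by (auto simp: incident_def items'_def)
  have "solve k ord items' \<noteq> []"
  proof (rule step.IH)
    show "distinct (map entry_edge items' @ map entry_edge ord)"
      using step.prems(1) by (auto simp: items'_def)
    show "\<forall>(c, p, e) \<in> set ord. \<exists>d. \<forall>e' \<in> incident ord items' c. \<chi> e' \<in> {\<chi> e, d}"
    proof clarify
      fix c' p' u v assume "(c', p', u, v) \<in> set ord"
      then obtain d where "\<forall>e' \<in> incident ((c, p, e) # ord) items c'. \<chi> e' \<in> {\<chi> (u, v), d}"
        using step.prems(2) by fastforce
      with inc[of c'] show "\<exists>d. \<forall>e' \<in> incident ord items' c'. \<chi> e' \<in> {\<chi> (u, v), d}" by blast
    qed
    show "load \<chi> d ord items' \<le> k" for d
      using step.prems(3)[of d] step.hyps a e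
      by (auto simp: items'_def load_Cons load_item split: if_splits)
  qed
  then show ?case using ak by (simp add: aw Let_def items'_def)
qed

lemma lookup_paint:
  "lookup e (paint (map (\<lambda>(p, f, e). (if Q e then Suc c else 0, e)) J) g r) =
     (if e \<in> entry_edge ` set J then (if Q e then Suc c else g) else lookup e r)"
proof (induction J)
  case (Cons x J)
  then show ?case by (cases x) auto
qed auto

text \<open>The third conjunct makes the induction work: colors used before \<open>c\<close> is put
  back are 0 or successors of vertices other than \<open>c\<close>, so \<open>Suc c\<close> really
  is fresh and its load consists only of the items selected at \<open>c\<close>. The color inherited
  at \<open>c\<close> keeps its load, as the item of weight \<open>Suc a\<close> is replaced by
  items of total weight \<open>a\<close> and the edge \<open>e\<close>.\<close>

lemma solve_sound:
  assumes "tree_order ord" and "distinct (map entry_edge items @ map entry_edge ord)"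
    and "solve k ord items \<noteq> []"
  defines "L \<equiv> \<lambda>e. lookup e (solve k ord items)"
  shows "(\<forall>(c, p, e) \<in> set ord. \<forall>e' \<in> incident ord items c. L e' \<in> {L e, Suc c}) \<and>
    (\<forall>d. load L d ord items \<le> k) \<and> (\<forall>e. L e \<in> insert 0 (Suc ` fst ` set ord))"
  using assms(1-3) unfolding L_def
proof (induction arbitrary: items rule: tree_order.induct)
  case root
  have dist: "distinct (map entry_edge items)" and z: "(0, 0) \<notin> entry_edge ` set items" using root by auto
  obtain Q where Q: "the (pick (table 0 items k)) =
       (wsum (\<lambda>p e. p = 0 \<and> \<not> Q e) items,
        map (\<lambda>(p, f, e). (if Q e then Suc 0 else 0, e)) (filter (\<lambda>(p, f, e). p = 0) items))"
     "wsum (\<lambda>p e. p = 0 \<and> Q e) items \<le> k"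
    by (rule best_split[OF dist, of 0 k], rule that)
  have ak: "wsum (\<lambda>p e. p = 0 \<and> \<not> Q e) items \<le> k"
    using root(2) by (simp add: Q(1) Let_def split: if_splits)
  define L where "L e = lookup e (solve k [(0, 0, 0, 0)] items)" for e
  have L: "L e = (if e \<in> entry_edge ` set (filter (\<lambda>(p, f, e). p = 0) items) \<and> Q e then Suc 0 else 0)" for e
    using ak by (simp add: L_def Q(1) Let_def lookup_paint)
  have L_0: "L e = (if Q e then Suc 0 else 0)" if "(0, f, e) \<in> set items" for f e
  proof -
    have "e \<in> entry_edge ` set (filter (\<lambda>(p, f, e). p = 0) items)"
      using that by (intro image_eqI[of _ _ "(0, f, e)"]) auto
    then show ?thesis by (simp add: L)
  qed
  have "load L d [(0, 0, 0, 0)] items \<le> k" for d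
  proof -
    consider "d = 0" | "d = Suc 0" | "d \<noteq> 0" "d \<noteq> Suc 0" by blast
    then have "wsum (\<lambda>p e. p = 0 \<and> L e = d) items \<le> k"
    proof cases
      case 1
      have "wsum (\<lambda>p e. p = 0 \<and> L e = d) items = wsum (\<lambda>p e. p = 0 \<and> \<not> Q e) items"
        by (rule wsum_cong) (use L_0 1 in auto)
      with ak show ?thesis by simp
    next
      case 2
      have "wsum (\<lambda>p e. p = 0 \<and> L e = d) items = wsum (\<lambda>p e. p = 0 \<and> Q e) items"
        by (rule wsum_cong) (use L_0 2 in \<open>auto split: if_splits\<close>)
      with Q(2) show ?thesis by simp
    next
      case 3
      have "wsum (\<lambda>p e. p = 0 \<and> L e = d) items = 0"
        by (rule wsum_False) (use L_0 3 in \<open>auto split: if_splits\<close>)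
      then show ?thesis by simp
    qed
    then show ?thesis by (simp add: load_Cons)
  qed
  moreover have "L e \<in> {0, Suc 0}" for e by (simp add: L)
  moreover have "L (0, 0) = 0" using z by (force simp: L)
  ultimately show ?case unfolding L_def[symmetric] by simp
next
  case (step ord c p e)
  have dist: "distinct (map entry_edge items)" using step.prems by auto
  obtain Q where Q: "the (pick (table c items k)) =
       (wsum (\<lambda>p e. p = c \<and> \<not> Q e) items,
        map (\<lambda>(p, f, e). (if Q e then Suc c else 0, e)) (filter (\<lambda>(p, f, e). p = c) items))"
     "wsum (\<lambda>p e. p = c \<and> Q e) items \<le> k"
    by (rule best_split[OF dist, of c k], rule that)
  define a where "a = wsum (\<lambda>p e. p = c \<and> \<not> Q e) items"
  define items' where "items' = (p, Suc a, e) # items"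
  define L' where "L' e = lookup e (solve k ord items')" for e
  define L where "L e' = lookup e' (solve k ((c, p, e) # ord) items)" for e'
  have ne: "a \<le> k" "solve k ord items' \<noteq> []"
    using step.prems(2) by (simp_all add: Q(1) a_def items'_def Let_def split: if_splits)
  then have L: "L e' = (if e' \<in> entry_edge ` set (filter (\<lambda>(p, f, e). p = c) items)
      then (if Q e' then Suc c else L' e) else L' e')" for e'
    by (simp add: Q(1) a_def items'_def L'_def L_def Let_def lookup_paint)
  have dist': "distinct (map entry_edge items' @ map entry_edge ord)"
    using step.prems(1) by (auto simp: items'_def)
  note IH = step.IH[OF dist' ne(2), folded L'_def]
  have L_c: "L e' = (if Q e' then Suc c else L' e)" if "(c, f, e') \<in> set items" for f e'
  proof -
    have "e' \<in> entry_edge ` set (filter (\<lambda>(p, f, e). p = c) items)"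
      using that by (intro image_eqI[of _ _ "(c, f, e')"]) auto
    then show ?thesis by (simp add: L)
  qed
  \<comment> \<open>Painting at \<open>c\<close> goes by edge only; distinct edges ensure that items
    at other vertices are not recolored.\<close>
  have L_other: "L e' = L' e'" if "(q, f, e') \<in> set items" "q \<noteq> c" for q f e'
  proof -
    have "e' \<notin> entry_edge ` set (filter (\<lambda>(p, f, e). p = c) items)"
    proof
      assume "e' \<in> entry_edge ` set (filter (\<lambda>(p, f, e). p = c) items)"
      then obtain f' where "(c, f', e') \<in> set items" by auto
      with that dist show False
        using inj_onD[of entry_edge "set items" "(q, f, e')" "(c, f', e')"] by (auto simp: distinct_map)
    qed
    then show ?thesis by (simp add: L)
  qed
  have L_ord: "L e' = L' e'" if "(c', p', e') \<in> set ((c, p, e) # ord)" for c' p' e'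
  proof -
    have "e' \<in> entry_edge ` set ((c, p, e) # ord)" using that by force
    then have "e' \<notin> entry_edge ` set items" using step.prems(1) by auto
    then show ?thesis by (auto simp: L)
  qed
  have fresh: "L' e' \<noteq> Suc c" for e'
  proof -
    have "L' e' \<in> insert 0 (Suc ` fst ` set ord)" using IH by blast
    with step.hyps(2) show ?thesis by (metis insertE imageE nat.distinct(1) nat.inject)
  qed
  have e: "e \<noteq> (0, 0)" using step.hyps by auto
  have "load L d ord items = load L' d ord items" for d
  proof -
    have "wsum (\<lambda>p e. p \<in> fst ` set ord \<and> L e = d) items = wsum (\<lambda>p e. p \<in> fst ` set ord \<and> L' e = d) items"
      by (rule wsum_cong) (use L_other step.hyps(2) in metis)
    moreover have "filter (\<lambda>(c, p, e). e \<noteq> (0, 0) \<and> L e = d) ord = filter (\<lambda>(c, p, e). e \<noteq> (0, 0) \<and> L' e = d) ord"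
    proof (rule filter_cong[OF refl])
      fix x assume "x \<in> set ord"
      moreover obtain c' p' e' where "x = (c', p', e')" by (cases x)
      ultimately show "(case x of (c, p, e) \<Rightarrow> e \<noteq> (0, 0) \<and> L e = d) \<longleftrightarrow>
          (case x of (c, p, e) \<Rightarrow> e \<noteq> (0, 0) \<and> L' e = d)"
        using L_ord[of c' p' e'] by simp
    qed
    ultimately show ?thesis by (simp add: load_def)
  qed
  then have load: "load L d ((c, p, e) # ord) items =
      wsum (\<lambda>q e. q = c \<and> L e = d) items + (if L' e = d then 1 else 0) + load L' d ord items" for d
    using step.hyps(2) e L_ord[of c p e] by (simp add: load_Cons)
  have IH_load: "(if L' e = d then Suc a else 0) + load L' d ord items \<le> k" for d
    using IH step.hyps(3) by (simp add: items'_def load_item)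
  have "load L d ((c, p, e) # ord) items \<le> k" for d
  proof -
    consider "d = L' e" | "d = Suc c" | "d \<noteq> L' e" "d \<noteq> Suc c" by blast
    then show ?thesis
    proof cases
      case 1
      have "wsum (\<lambda>q e. q = c \<and> L e = d) items = a"
        unfolding a_def by (rule wsum_cong) (use L_c fresh[of e] 1 in \<open>auto split: if_splits\<close>)
      with 1 IH_load[of d] show ?thesis by (simp add: load)
    next
      case 2
      have "wsum (\<lambda>q e. q = c \<and> L e = d) items = wsum (\<lambda>p e. p = c \<and> Q e) items"
        by (rule wsum_cong) (use L_c fresh[of e] 2 in \<open>auto split: if_splits\<close>)
      moreover have "load L' d ord items = 0"
        using fresh by (auto simp: load_def 2 intro!: wsum_False)
      ultimately show ?thesis using 2 fresh[of e] Q(2) by (simp add: load)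
    next
      case 3
      have "wsum (\<lambda>q e. q = c \<and> L e = d) items = 0"
        by (rule wsum_False) (use L_c 3 in \<open>auto split: if_splits\<close>)
      with 3 IH_load[of d] show ?thesis by (simp add: load)
    qed
  qed
  moreover have "L e' \<in> {L e'', Suc c'}"
    if c': "(c', p', e'') \<in> set ((c, p, e) # ord)" and e': "e' \<in> incident ((c, p, e) # ord) items c'" for c' p' e' e''
  proof (cases "c' = c")
    case True
    then have "e'' = e" using c' step.hyps(2) by force
    moreover obtain f where "(c, f, e') \<in> set items"
    proof -
      \<comment> \<open>As a leaf of the current tree, \<open>c\<close> is the parent of no entry,
        so all its downward edges are items.\<close>
      have "(c'', c, e') \<notin> set ((c, p, e) # ord)" for c''
        using step.hyps(2,3) tree_order_endpoints[OF step.hyps(1), of c'' c "fst e'" "snd e'"] by auto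
      with e' that show thesis unfolding incident_def True by blast
    qed
    ultimately show ?thesis using L_c[of f e'] L_ord[of c p e] True by simp
  next
    case False
    then have ord: "(c', p', e'') \<in> set ord" using c' by auto
    have e'2: "e' \<in> incident ord items' c'" using e' by (auto simp: incident_def items'_def)
    with IH ord have "L' e' \<in> {L' e'', Suc c'}" by fastforce
    moreover have "L e' = L' e'"
      using e' L_other[of c' _ e'] False L_ord[of _ c' e'] by (auto simp: incident_def)
    moreover have "L e'' = L' e''" using L_ord[OF c'] .
    ultimately show ?thesis by simp
  qed
  moreover have "L e' \<in> insert 0 (Suc ` fst ` set ((c, p, e) # ord))" for e'
  proof -
    have "L' e'' \<in> insert 0 (Suc ` fst ` set ord)" for e'' using IH by blast
    then have "L' e'' \<in> insert 0 (Suc ` fst ` set ((c, p, e) # ord))" for e'' by fastforce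
    then show ?thesis unfolding L by simp
  qed
  ultimately show ?case unfolding L_def[symmetric] by blast
qed

section \<open>Rooting the input tree\<close>

lemma find_edge_Some:
  "find_edge es S = Some (c, p, e) \<Longrightarrow>
    e \<in> set es \<and> c \<notin> S \<and> p \<in> S \<and> (e = (c, p) \<or> e = (p, c))"
  by (induction es S rule: find_edge.induct) (auto split: if_splits)

lemma find_edge_None: "find_edge es S = None \<Longrightarrow> (u, v) \<in> set es \<Longrightarrow> u \<in> S \<longleftrightarrow> v \<in> S"
  by (induction es S rule: find_edge.induct) (auto split: if_splits)

lemma grow_tree_order: "tree_order ord \<Longrightarrow> tree_order (grow m es ord)"
proof (induction m arbitrary: ord)
  case (Suc m)
  show ?case
  proof (cases "find_edge es (fst ` set ord)")
    case (Some x)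
    then have "tree_order (x # ord)"
      using find_edge_Some[of es "fst ` set ord"] Suc.prems by (cases x) (auto intro: tree_order.step)
    with Suc.IH Some show ?thesis by simp
  qed (use Suc in auto)
qed auto

lemma grow_edges:
  "entry_edge ` set (grow m es ord) \<subseteq> entry_edge ` set ord \<union> set es"
proof (induction m arbitrary: ord)
  case (Suc m)
  show ?case
  proof (cases "find_edge es (fst ` set ord)")
    case (Some x)
    then have "entry_edge x \<in> set es"
      using find_edge_Some[of es "fst ` set ord"] by (cases x) auto
    with Suc.IH[of "x # ord"] Some show ?thesis by auto
  qed auto
qed auto

lemma grow_saturated:
  "find_edge es (fst ` set (grow m es ord)) = None \<or> length (grow m es ord) = length ord + m"
proof (induction m arbitrary: ord)
  case (Suc m)
  show ?case
  proof (cases "find_edge es (fst ` set ord)")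
    case (Some x)
    with Suc.IH[of "x # ord"] show ?thesis by auto
  qed auto
qed auto

abbreviation tree_edges :: "vertex_entry list \<Rightarrow> nat set set" where
  "tree_edges ord \<equiv> edge_of ` (entry_edge ` set ord - {(0, 0)})"

lemma is_walk_mono: "is_walk V E p \<Longrightarrow> V \<subseteq> V' \<Longrightarrow> E \<subseteq> E' \<Longrightarrow> is_walk V' E' p"
  by (auto simp: is_walk_def elim!: successively_mono)

lemma is_walk_Cons:
  "is_walk V E p \<Longrightarrow> u \<in> V \<Longrightarrow> {u, hd p} \<in> E \<Longrightarrow> is_walk V E (u # p)"
  by (auto simp: is_walk_def successively_Cons)

lemma is_walk_snoc:
  "is_walk V E p \<Longrightarrow> u \<in> V \<Longrightarrow> {last p, u} \<in> E \<Longrightarrow> is_walk V E (p @ [u])"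
  by (auto simp: is_walk_def successively_append_iff)

text \<open>A path to or from the new leaf extends a path ending or starting at its parent.
  Distinctness is carried along because the path is later closed to a cycle.\<close>

lemma tree_order_path:
  "tree_order ord \<Longrightarrow> u \<in> fst ` set ord \<Longrightarrow> v \<in> fst ` set ord \<Longrightarrow>
    \<exists>w. is_walk (fst ` set ord) (tree_edges ord) w \<and> distinct w \<and> hd w = u \<and> last w = v"
proof (induction arbitrary: u v rule: tree_order.induct)
  case root
  then show ?case by (intro exI[of _ "[0]"]) (auto simp: is_walk_def)
next
  case (step ord c p e)
  let ?V = "fst ` set ((c, p, e) # ord)" and ?E = "tree_edges ((c, p, e) # ord)"
  have sub: "fst ` set ord \<subseteq> ?V" "tree_edges ord \<subseteq> ?E" by auto
  have "edge_of e \<in> ?E" using step.hyps by (intro imageI) auto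
  then have e: "{c, p} \<in> ?E" "{p, c} \<in> ?E"
    using step.hyps(4) by (auto simp: edge_of_def insert_commute)
  have fresh: "c \<notin> set w" if "is_walk (fst ` set ord) (tree_edges ord) w" for w
    using that step.hyps(2) by (auto simp: is_walk_def)
  consider "u = c" "v = c" | "u = c" "v \<in> fst ` set ord" | "v = c" "u \<in> fst ` set ord"
    | "u \<in> fst ` set ord" "v \<in> fst ` set ord"
    using step.prems by auto
  then show ?case
  proof cases
    case 1
    then show ?thesis by (intro exI[of _ "[c]"]) (auto simp: is_walk_def)
  next
    case 2
    obtain w where w: "is_walk (fst ` set ord) (tree_edges ord) w" "distinct w" "hd w = p" "last w = v"
      using step.IH[OF step.hyps(3) 2(2)] by blast
    have "is_walk ?V ?E (c # w)"
      by (rule is_walk_Cons[OF is_walk_mono[OF w(1) sub]]) (use e w in auto)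
    with w fresh[OF w(1)] 2 show ?thesis by (intro exI[of _ "c # w"]) (auto simp: is_walk_def)
  next
    case 3
    obtain w where w: "is_walk (fst ` set ord) (tree_edges ord) w" "distinct w" "hd w = u" "last w = p"
      using step.IH[OF 3(2) step.hyps(3)] by blast
    have "is_walk ?V ?E (w @ [c])"
      by (rule is_walk_snoc[OF is_walk_mono[OF w(1) sub]]) (use e w in auto)
    with w fresh[OF w(1)] 3 show ?thesis by (intro exI[of _ "w @ [c]"]) (auto simp: is_walk_def)
  next
    case 4
    with step.IH[OF 4] is_walk_mono[OF _ sub] show ?thesis by blast
  qed
qed

lemma tree_order_root: "tree_order ord \<Longrightarrow> (0, 0, 0, 0) \<in> set ord"
  by (induction rule: tree_order.induct) auto

lemma tree_order_edge_cases:
  "tree_order ord \<Longrightarrow> (c, p, e) \<in> set ord \<Longrightarrow> (c, p, e) = (0, 0, 0, 0) \<or> (e = (c, p) \<or> e = (p, c)) \<and> c \<noteq> p \<and> c \<noteq> 0"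
proof (induction rule: tree_order.induct)
  case (step ord c' p' e')
  then have "c' \<noteq> 0" "c' \<noteq> p'" using tree_order_root[OF step.hyps(1)] by force+
  with step show ?case by auto
qed auto

lemma walk_closed:
  assumes "\<And>u v. {u, v} \<in> E \<Longrightarrow> u \<in> S \<Longrightarrow> v \<in> S"
  shows "successively (\<lambda>u v. {u, v} \<in> E) w \<Longrightarrow> w \<noteq> [] \<Longrightarrow> hd w \<in> S \<Longrightarrow> set w \<subseteq> S"
proof (induction w rule: induct_list012)
  case (3 x y w)
  then show ?case using assms by auto
qed auto

lemma edge_of_eq_doubleton: "edge_of e = {u, v} \<longleftrightarrow> e = (u, v) \<or> e = (v, u)"
  by (cases e) (auto simp: edge_of_def doubleton_eq_iff)

lemma presents_tree_edge:
  assumes "presents_tree n es" "(u, v) \<in> set es"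
  shows "u < n" "v < n" "u \<noteq> v"
proof -
  have "edge_of (u, v) \<subseteq> {..<n}" "card (edge_of (u, v)) = 2"
    using assms by (auto simp: presents_tree_def finite_tree_def simple_graph_def)
  then show "u < n" "v < n" "u \<noteq> v" by (auto simp: edge_of_def)
qed

lemma presents_tree_pos: "presents_tree n es \<Longrightarrow> 0 < n"
  by (auto simp: presents_tree_def finite_tree_def connected_graph_def)

lemma presents_tree_inj: "presents_tree n es \<Longrightarrow> inj_on edge_of (set es)"
  by (auto simp: presents_tree_def distinct_map)

definition rooted :: "nat \<Rightarrow> edge list \<Rightarrow> vertex_entry list" where
  "rooted n es = grow n es [(0, 0, 0, 0)]"

lemma rooted_tree_order: "tree_order (rooted n es)"
  unfolding rooted_def by (intro grow_tree_order tree_order.root)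

lemma rooted_edges_subset: "entry_edge ` set (rooted n es) \<subseteq> insert (0, 0) (set es)"
  using grow_edges[of n es "[(0, 0, 0, 0)]"] by (auto simp: rooted_def)

lemma rooted_vertices:
  assumes "presents_tree n es"
  shows "fst ` set (rooted n es) = {..<n}"
proof
  let ?S = "fst ` set (rooted n es)"
  have root: "0 \<in> ?S" using tree_order_root[OF rooted_tree_order] by force
  show sub: "?S \<subseteq> {..<n}"
  proof
    fix c assume "c \<in> ?S"
    then obtain p e where cpe: "(c, p, e) \<in> set (rooted n es)" by auto
    have "entry_edge (c, p, e) \<in> entry_edge ` set (rooted n es)" using cpe by (rule imageI)
    then have es: "e = (0, 0) \<or> e \<in> set es" using rooted_edges_subset by auto
    have "(c, p, e) = (0, 0, 0, 0) \<or> e = (c, p) \<and> e \<noteq> (0, 0) \<or> e = (p, c) \<and> e \<noteq> (0, 0)"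
      using tree_order_edge_cases[OF rooted_tree_order cpe] by auto
    then show "c \<in> {..<n}"
    proof (elim disjE)
      assume "(c, p, e) = (0, 0, 0, 0)"
      then show ?thesis using presents_tree_pos[OF assms] by simp
    next
      assume e: "e = (c, p) \<and> e \<noteq> (0, 0)"
      then have "e \<in> set es" using es by blast
      then show ?thesis using e presents_tree_edge[OF assms] by blast
    next
      assume e: "e = (p, c) \<and> e \<noteq> (0, 0)"
      then have "e \<in> set es" using es by blast
      then show ?thesis using e presents_tree_edge[OF assms] by blast
    qed
  qed
  have "length (rooted n es) = card ?S"
    using tree_order_distinct[OF rooted_tree_order] by (metis distinct_card list.set_map length_map)
  also have "\<dots> \<le> n" using card_mono[OF _ sub] by simp
  \<comment> \<open>Had all \<open>n\<close> rounds succeeded, the list would have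
    \<open>n + 1\<close> entries with distinct vertices below \<open>n\<close>.\<close>
  finally have none: "find_edge es ?S = None"
    using grow_saturated[of es n "[(0, 0, 0, 0)]"] by (auto simp: rooted_def)
  \<comment> \<open>No edge leaves the collected set, so every walk from 0 stays inside, and
    connectedness gives all vertices.\<close>
  have closed: "v \<in> ?S" if uv: "{u, v} \<in> edge_of ` set es" "u \<in> ?S" for u v
  proof -
    obtain e where e: "e \<in> set es" "edge_of e = {u, v}" using uv(1) by (metis imageE)
    then have "(u, v) \<in> set es \<or> (v, u) \<in> set es" unfolding edge_of_eq_doubleton by blast
    with uv(2) find_edge_None[OF none] show ?thesis by blast
  qed
  show "{..<n} \<subseteq> ?S"
  proof
    fix v assume v: "v \<in> {..<n}"
    have "connected_graph {..<n} (edge_of ` set es)"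
      using assms by (simp add: presents_tree_def finite_tree_def)
    from this[unfolded connected_graph_def, THEN conjunct2, rule_format, OF _ v, of 0]
    obtain w where w: "is_walk {..<n} (edge_of ` set es) w" "hd w = 0" "last w = v"
      using presents_tree_pos[OF assms] by auto
    then have "set w \<subseteq> ?S"
      using walk_closed[of "edge_of ` set es" ?S w, OF closed] root by (simp add: is_walk_def)
    moreover have "v \<in> set w" using w by (auto simp: is_walk_def)
    ultimately show "v \<in> ?S" by blast
  qed
qed

lemma length_rooted: "presents_tree n es \<Longrightarrow> length (rooted n es) = n"
  using tree_order_distinct[OF rooted_tree_order[of n es]] rooted_vertices
  by (metis card_lessThan distinct_card length_map list.set_map)

text \<open>An edge missing from the rooted tree would close a cycle with a path in it.\<close>

lemma rooted_edges:
  assumes "presents_tree n es"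
  shows "entry_edge ` set (rooted n es) = insert (0, 0) (set es)"
proof (rule equalityI[OF rooted_edges_subset], rule ccontr)
  let ?R = "rooted n es"
  assume "\<not> insert (0, 0) (set es) \<subseteq> entry_edge ` set ?R"
  moreover have "(0, 0) \<in> entry_edge ` set ?R"
    using tree_order_root[OF rooted_tree_order] by force
  ultimately obtain u v where uv: "(u, v) \<in> set es" "(u, v) \<notin> entry_edge ` set ?R" by auto
  note edge = presents_tree_edge[OF assms uv(1)]
  have sub: "entry_edge ` set ?R - {(0, 0)} \<subseteq> set es"
    using rooted_edges_subset by blast
  have notin: "{u, v} \<notin> tree_edges ?R"
  proof
    assume "{u, v} \<in> tree_edges ?R"
    then obtain e where e: "e \<in> entry_edge ` set ?R - {(0, 0)}" "edge_of e = edge_of (u, v)"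
      by (auto simp: edge_of_def)
    then have "e = (u, v)"
      using inj_onD[OF presents_tree_inj[OF assms]] sub uv(1) by blast
    with e(1) have "(u, v) \<in> entry_edge ` set ?R" by (metis DiffD1)
    with uv(2) show False by contradiction
  qed
  obtain w where w: "is_walk {..<n} (tree_edges ?R) w" "distinct w" "hd w = u" "last w = v"
    using tree_order_path[OF rooted_tree_order, of u n es v] edge by (auto simp: rooted_vertices[OF assms])
  \<comment> \<open>A shorter path would mean \<open>u = v\<close> or make \<open>{u, v}\<close> a
    tree edge.\<close>
  have "length w \<ge> 3"
  proof (rule ccontr)
    assume "\<not> length w \<ge> 3"
    then consider "w = []" | x where "w = [x]" | x y where "w = [x, y]"
      by (cases w; cases "tl w"; cases "tl (tl w)") auto
    then show False using w notin edge by cases (auto simp: is_walk_def)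
  qed
  moreover have "is_walk {..<n} (edge_of ` set es) w"
    by (rule is_walk_mono[OF w(1)]) (use sub in auto)
  moreover have "{last w, hd w} \<in> edge_of ` set es"
    using uv(1) w by (intro image_eqI[of _ _ "(u, v)"]) (auto simp: edge_of_def)
  ultimately show False
    using assms w(2) by (auto simp: presents_tree_def finite_tree_def is_cycle_def)
qed

lemma rooted_edge_mem:
  assumes "presents_tree n es" "(c, p, e) \<in> set (rooted n es)"
  shows "e \<in> insert (0, 0) (set es)"
  using imageI[OF assms(2), of entry_edge] by (simp add: rooted_edges[OF assms(1)])

text \<open>Without items, the load of a color is exactly this count; so the potential before any
  vertex is processed is the size of the color group.\<close>

lemma length_filter_rooted:
  assumes "presents_tree n es" and "\<And>e. e \<in> set es \<Longrightarrow> \<chi> e = col (edge_of e)"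
  shows "length (filter (\<lambda>(c, p, e). e \<noteq> (0, 0) \<and> \<chi> e = d) (rooted n es)) =
    card (color_group (edge_of ` set es) col d)"
proof -
  let ?R = "rooted n es"
  have z: "(0, 0) \<notin> set es" using presents_tree_edge[OF assms(1)] by blast
  have "length (filter (\<lambda>(c, p, e). e \<noteq> (0, 0) \<and> \<chi> e = d) ?R) =
    length (filter (\<lambda>e. e \<noteq> (0, 0) \<and> \<chi> e = d) (map entry_edge ?R))"
    by (simp add: filter_map comp_def case_prod_beta') (metis (no_types, lifting) entry_edge.simps prod.collapse)
  also have "\<dots> = card (set (filter (\<lambda>e. e \<noteq> (0, 0) \<and> \<chi> e = d) (map entry_edge ?R)))"
    using tree_order_distinct[OF rooted_tree_order, of n es] by (intro distinct_card[symmetric]) auto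
  also have "set (filter (\<lambda>e. e \<noteq> (0, 0) \<and> \<chi> e = d) (map entry_edge ?R)) = {e \<in> set es. col (edge_of e) = d}"
    using assms(2) z by (auto simp: rooted_edges[OF assms(1)])
  also have "card \<dots> = card (edge_of ` {e \<in> set es. col (edge_of e) = d})"
    using presents_tree_inj[OF assms(1)] by (intro card_image[symmetric]) (auto intro: inj_on_subset)
  also have "edge_of ` {e \<in> set es. col (edge_of e) = d} = color_group (edge_of ` set es) col d"
    by (auto simp: color_group_def)
  finally show ?thesis .
qed

section \<open>Completeness and soundness for the input tree\<close>

lemma largest_group_size_le_iff:
  assumes "finite E"
  shows "largest_group_size E col \<le> k \<longleftrightarrow> (\<forall>d. card (color_group E col d) \<le> k)"
proof -
  have "range (\<lambda>c. card (color_group E col c)) \<subseteq> {..card E}"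
    using assms by (auto simp: color_group_def intro!: card_mono)
  then have "finite (range (\<lambda>c. card (color_group E col c)))"
    by (rule finite_subset) simp
  then show ?thesis by (auto simp: largest_group_size_def)
qed

lemma card_2_insert:
  assumes "card C \<le> 2" "finite C" "x \<in> C"
  shows "\<exists>d. C \<subseteq> {x, d}"
proof -
  have "card (C - {x}) \<le> Suc 0" "finite (C - {x})" using assms by simp_all
  then have eq: "\<forall>a \<in> C - {x}. \<forall>b \<in> C - {x}. a = b" by (simp add: card_le_Suc0_iff_eq)
  show ?thesis
  proof (cases "C \<subseteq> {x}")
    case False
    then obtain d where "d \<in> C - {x}" by blast
    with eq show ?thesis by (intro exI[of _ d]) auto
  qed blast
qed

lemma solve_rooted_complete:
  assumes pres: "presents_tree n es"
    and col: "edge_2_coloring {..<n} (edge_of ` set es) col"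
    and le: "largest_group_size (edge_of ` set es) col \<le> k"
  shows "solve k (rooted n es) [] \<noteq> []"
proof -
  let ?E = "edge_of ` set es" and ?R = "rooted n es"
  have z: "(0, 0) \<notin> set es" using presents_tree_edge[OF pres] by blast
  define C where "C v = col ` {e \<in> ?E. v \<in> e}" for v
  have C: "card (C v) \<le> 2" "finite (C v)" if "v < n" for v
    using col that by (auto simp: edge_2_coloring_def C_def)
  \<comment> \<open>The dummy edge needs a color compatible with the root: any color already present
    at 0 will do. If 0 has no edges, the choice is immaterial.\<close>
  define x where "x = (SOME x. x \<in> C 0)"
  define \<chi> where "\<chi> e = (if e = (0, 0) then x else col (edge_of e))" for e
  have \<chi>_C: "\<chi> e \<in> C v" if "e \<in> set es" "v = fst e \<or> v = snd e" for e v
    using that z by (auto simp: \<chi>_def C_def edge_of_def)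
  have inc: "e' \<in> set es \<and> (fst e' = c \<or> snd e' = c) \<or> c = 0 \<and> e' = (0, 0)" if e': "e' \<in> incident ?R [] c" for e' c
  proof -
    obtain c' where c': "(c', c, e') \<in> set ?R" using e' unfolding incident_def by auto
    then have "e' \<in> insert (0, 0) (set es)" by (rule rooted_edge_mem[OF pres])
    then show ?thesis using tree_order_edge_cases[OF rooted_tree_order c'] by auto
  qed
  have "\<exists>d. \<forall>e' \<in> incident ?R [] c. \<chi> e' \<in> {\<chi> e, d}" if cpe: "(c, p, e) \<in> set ?R" for c p e
  proof (cases "c = 0")
    case True
    then have e: "e = (0, 0)" using tree_order_edge_cases[OF rooted_tree_order cpe] by auto
    show ?thesis
    proof (cases "C 0 = {}")
      case True
      then have "e' = (0, 0)" if "e' \<in> incident ?R [] c" for e'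
        using inc[OF that] \<chi>_C[of e' 0] \<open>c = 0\<close> by auto
      then show ?thesis using e by auto
    next
      case False
      then have x: "x \<in> C 0" unfolding x_def by (simp add: some_in_eq)
      obtain d where d: "C 0 \<subseteq> {x, d}"
        using card_2_insert[OF C x] presents_tree_pos[OF pres] by blast
      have "\<chi> e' \<in> {\<chi> e, d}" if "e' \<in> incident ?R [] c" for e'
        using inc[OF that] \<chi>_C[of e' 0] d \<open>c = 0\<close> e by (auto simp: \<chi>_def)
      then show ?thesis by blast
    qed
  next
    case False
    then have e: "e = (c, p) \<or> e = (p, c)" "e \<noteq> (0, 0)"
      using tree_order_edge_cases[OF rooted_tree_order cpe] by auto
    then have es: "e \<in> set es" using rooted_edge_mem[OF pres cpe] by blast
    then have "c < n" using e presents_tree_edge[OF pres] by blast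
    moreover have "\<chi> e \<in> C c" using \<chi>_C[OF es] e by auto
    ultimately obtain d where d: "C c \<subseteq> {\<chi> e, d}" using card_2_insert[OF C] by blast
    have "\<chi> e' \<in> {\<chi> e, d}" if "e' \<in> incident ?R [] c" for e'
    proof -
      have "\<chi> e' \<in> C c" using inc[OF that] \<chi>_C[of e' c] False by blast
      with d show ?thesis by blast
    qed
    then show ?thesis by blast
  qed
  then have two: "\<forall>(c, p, e) \<in> set ?R. \<exists>d. \<forall>e' \<in> incident ?R [] c. \<chi> e' \<in> {\<chi> e, d}" by blast
  have load: "load \<chi> d ?R [] \<le> k" for d
  proof -
    have "\<chi> e = col (edge_of e)" if "e \<in> set es" for e using that z by (auto simp: \<chi>_def)
    with le show ?thesis by (simp add: load_def length_filter_rooted[OF pres] largest_group_size_le_iff)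
  qed
  show ?thesis
    by (rule solve_complete[OF rooted_tree_order _ two load])
      (use tree_order_distinct[OF rooted_tree_order] in auto)
qed

text \<open>Colorings act on sets of endpoints, results of \<open>solve\<close> on pairs; the
  inverse recovers the orientation used in the input.\<close>

definition tree_coloring :: "nat \<Rightarrow> nat \<Rightarrow> edge list \<Rightarrow> nat set \<Rightarrow> nat" where
  "tree_coloring k n es F = lookup (the_inv_into (set es) edge_of F) (solve k (rooted n es) [])"

lemma tree_coloring_edge:
  "presents_tree n es \<Longrightarrow> e \<in> set es \<Longrightarrow>
    tree_coloring k n es (edge_of e) = lookup e (solve k (rooted n es) [])"
  by (simp add: tree_coloring_def the_inv_into_f_f[OF presents_tree_inj])

lemma solve_rooted_sound:
  assumes pres: "presents_tree n es" and ne: "solve k (rooted n es) [] \<noteq> []"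
  shows "edge_2_coloring {..<n} (edge_of ` set es) (tree_coloring k n es)"
    and "largest_group_size (edge_of ` set es) (tree_coloring k n es) \<le> k"
proof -
  let ?R = "rooted n es" and ?L = "\<lambda>e. lookup e (solve k (rooted n es) [])"
  have dist: "distinct (map entry_edge [] @ map entry_edge ?R)"
    using tree_order_distinct[OF rooted_tree_order] by auto
  note sound = solve_sound[OF rooted_tree_order dist ne]
  show "largest_group_size (edge_of ` set es) (tree_coloring k n es) \<le> k"
    using sound length_filter_rooted[OF pres, of ?L, OF tree_coloring_edge[OF pres, symmetric]]
    by (simp add: largest_group_size_le_iff load_def)
  show "edge_2_coloring {..<n} (edge_of ` set es) (tree_coloring k n es)"
    unfolding edge_2_coloring_def
  proof
    fix v assume v: "v \<in> {..<n}"
    then obtain x where x: "x \<in> set ?R" "v = fst x"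
      using rooted_vertices[OF pres] by blast
    obtain p e where vpe: "(v, p, e) \<in> set ?R"
      using x by (metis prod.collapse)
    \<comment> \<open>An edge at \<open>v\<close> is either the edge \<open>e\<close> above it or
      leads down to a child. At the root \<open>e\<close> is the dummy edge, so the pair of
      available colors has the same form.\<close>
    have "tree_coloring k n es F \<in> {?L e, Suc v}" if F: "F \<in> edge_of ` set es" "v \<in> F" for F
    proof -
      obtain e' where e': "e' \<in> set es" "F = edge_of e'" using F by auto
      then have "e' \<in> entry_edge ` set ?R" using rooted_edges[OF pres] by simp
      then obtain y where y: "y \<in> set ?R" "e' = entry_edge y" by blast
      obtain c q where cq: "(c, q, e') \<in> set ?R"
        using y by (metis entry_edge.simps prod.collapse)
      have "e' \<noteq> (0, 0)" using e' presents_tree_edge[OF pres] by blast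
      then have "v = c \<or> v = q"
        using tree_order_edge_cases[OF rooted_tree_order cq] F(2) e'(2) by (auto simp: edge_of_def)
      then have "?L e' \<in> {?L e, Suc v}"
      proof
        assume "v = c"
        then have "e' = e"
          using cq vpe tree_order_distinct[OF rooted_tree_order, of n es]
          by (auto dest: eq_key_imp_eq_value)
        then show ?thesis by simp
      next
        assume "v = q"
        then have "e' \<in> incident ?R [] v" using cq by (auto simp: incident_def)
        with sound vpe show ?thesis by blast
      qed
      then show ?thesis using e' tree_coloring_edge[OF pres] by simp
    qed
    then have "tree_coloring k n es ` {F \<in> edge_of ` set es. v \<in> F} \<subseteq> {?L e, Suc v}" by blast
    then have "card (tree_coloring k n es ` {F \<in> edge_of ` set es. v \<in> F}) \<le> card {?L e, Suc v}"
      by (rule card_mono[rotated]) simp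
    also have "\<dots> \<le> 2" by (simp add: card_insert_if)
    finally show "card (tree_coloring k n es ` {F \<in> edge_of ` set es. v \<in> F}) \<le> 2" .
  qed
qed

section \<open>The polynomial bound\<close>

lemma length_es:
  assumes "presents_tree n es"
  shows "Suc (length es) = n"
proof -
  have "(0, 0) \<notin> set es" using presents_tree_edge[OF assms] by blast
  moreover have "distinct es" using assms by (auto simp: presents_tree_def distinct_map)
  ultimately have "Suc (length es) = card (insert (0, 0) (set es))" by (simp add: distinct_card)
  also have "\<dots> = card (set (map entry_edge (rooted n es)))" by (simp add: rooted_edges[OF assms])
  also have "\<dots> = n"
    using tree_order_distinct[OF rooted_tree_order, of n es] length_rooted[OF assms]
    by (simp add: distinct_card del: set_map)
  finally show ?thesis .
qed

definition "main_time m =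
  m * (find_time m + 40) + m * (solve_time m + 40) + m * (lookup_time (1 + m * m) m + 40) + 100"

lemma calls_main:
  assumes pres: "presents_tree n es" and K: "solve K (rooted n es) [] \<noteq> []"
    and min: "\<forall>j < K. solve j (rooted n es) [] = []" and le: "K < n"
  shows "calls prog main_fn [enc_input n es] (enc_output K es (tree_coloring K n es)) (main_time (n + 1))"
proof -
  \<comment> \<open>One more than the number of vertices, since the bound for \<open>grow\<close>
    adds the initial entry of the root to the fuel \<open>n\<close>.\<close>
  define m where "m = n + 1"
  have es: "set es \<subseteq> {..m} \<times> {..m}" "length es \<le> m"
    using presents_tree_edge[OF pres] length_es[OF pres] by (fastforce simp: m_def)+
  have R: "\<forall>(c, p, e) \<in> set (rooted n es). c \<le> m \<and> e \<in> {..m} \<times> {..m}"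
  proof clarify
    fix c p u v assume mem: "(c, p, u, v) \<in> set (rooted n es)"
    have "c \<in> fst ` set (rooted n es)" using mem by force
    moreover have "(u, v) \<in> {..m} \<times> {..m}"
      using rooted_edge_mem[OF pres mem] es(1) by auto
    ultimately show "c \<le> m \<and> (u, v) \<in> {..m} \<times> {..m}"
      by (simp add: rooted_vertices[OF pres] m_def)
  qed
  define r where "r = solve K (rooted n es) []"
  have grow: "calls prog grow_fn [enc_nat n, enc_list enc_edge es, enc_list enc_entry [(0, 0, 0, 0)]]
     (enc_list enc_entry (rooted n es)) (n * (find_time m + 40) + 10)"
    unfolding rooted_def by (rule calls_grow) (use es in \<open>auto simp: m_def\<close>)
  have search: "calls prog search_fn [enc_list enc_entry (rooted n es), enc_nat 0]
     (Node (enc_nat K) (enc_assoc r)) (Suc (K - 0) * (solve_time m + 40))"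
    unfolding r_def by (rule calls_search) (use R K min le length_rooted[OF pres] in \<open>auto simp: m_def\<close>)
  have "length r \<le> 1 + length (rooted n es) * (length (rooted n es) + length ([] :: item list))"
    unfolding r_def by (rule length_solve)
  also have "\<dots> \<le> 1 + m * m"
    using length_rooted[OF pres] by (simp add: m_def)
  finally have colors: "calls prog output_fn [enc_list enc_edge es, enc_assoc r]
     (enc_list enc_nat (map (\<lambda>e. lookup e r) es)) (length es * (lookup_time (1 + m * m) m + 40) + 10)"
    using es by (intro calls_output)
  have out: "map (\<lambda>e. lookup e r) es = map (\<lambda>e. tree_coloring K n es (edge_of e)) es"
    by (simp add: r_def tree_coloring_edge[OF pres])
  have "n * (find_time m + 40) \<le> m * (find_time m + 40)"
    "Suc K * (solve_time m + 40) \<le> m * (solve_time m + 40)"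
    "length es * (lookup_time (1 + m * m) m + 40) \<le> m * (lookup_time (1 + m * m) m + 40)"
    using es le by (auto simp: m_def simp del: mult_Suc intro!: mult_le_mono1)
  note times = this[unfolded add_mult_distrib2]
  show ?thesis
    unfolding calls_def m_def[symmetric] enc_input_def enc_output_def
    apply (subst wp_call_prog)
    apply (simp add: main_body_def)
    apply (rule wp_call_calls'[OF grow])
     apply simp
    apply simp
    apply (rule wp_call_calls'[OF search])
     apply simp
    apply simp
    apply (rule wp_call_calls[OF colors[simplified]])
    apply (simp add: out main_time_def algebra_simps)
    using times apply (simp add: algebra_simps)
    done
qed

lemma size_enc_list: "(\<And>x. x \<in> set xs \<Longrightarrow> size (f x) \<le> m) \<Longrightarrow> size (enc_list f xs) \<le> length xs * (m + 1)"
  by (induction xs) fastforce+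

text \<open>Every color is 0 or the successor of a vertex, hence at most \<open>n\<close>, so even
  in unary the list of colors has quadratic size.\<close>

lemma size_enc_output:
  assumes pres: "presents_tree n es" and K: "solve K (rooted n es) [] \<noteq> []" and le: "K < n"
  shows "size (enc_output K es (tree_coloring K n es)) \<le> n + n * (n + 1) + 1"
proof -
  have dist: "distinct (map entry_edge [] @ map entry_edge (rooted n es))"
    using tree_order_distinct[OF rooted_tree_order] by auto
  have color: "tree_coloring K n es F \<le> n" for F
  proof -
    have "tree_coloring K n es F \<in> insert 0 (Suc ` fst ` set (rooted n es))"
      unfolding tree_coloring_def using solve_sound[OF rooted_tree_order dist K] by blast
    then show ?thesis by (auto simp: rooted_vertices[OF pres])
  qed
  have "size (enc_list enc_nat (map (\<lambda>e. tree_coloring K n es (edge_of e)) es)) \<le>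
      length (map (\<lambda>e. tree_coloring K n es (edge_of e)) es) * (n + 1)"
    by (rule size_enc_list) (use color in auto)
  also have "\<dots> = length es * (n + 1)" by simp
  also have "\<dots> \<le> n * (n + 1)" using length_es[OF pres] by (intro mult_le_mono1) simp
  finally show ?thesis using le by (simp add: enc_output_def)
qed

text \<open>Equality with a polynomial, not just a bound, is available because the time bounds are
  built from constants and the argument by sums and products.\<close>

definition poly_fun :: "(nat \<Rightarrow> nat) \<Rightarrow> bool" where
  "poly_fun f \<longleftrightarrow> (\<exists>p :: nat poly. \<forall>x. f x = poly p x)"

lemma poly_fun_const: "poly_fun (\<lambda>x. c)"
  unfolding poly_fun_def by (rule exI[of _ "[:c:]"]) simp

lemma poly_fun_id: "poly_fun (\<lambda>x. x)"
  unfolding poly_fun_def by (rule exI[of _ "[:0, 1:]"]) simp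

lemma poly_fun_add: "poly_fun f \<Longrightarrow> poly_fun g \<Longrightarrow> poly_fun (\<lambda>x. f x + g x)"
  unfolding poly_fun_def by (metis poly_add)

lemma poly_fun_mult: "poly_fun f \<Longrightarrow> poly_fun g \<Longrightarrow> poly_fun (\<lambda>x. f x * g x)"
  unfolding poly_fun_def by (metis poly_mult)

lemma poly_fun_time: "poly_fun (\<lambda>n. main_time (n + 1) + 2 + (n + n * (n + 1) + 1))"
  unfolding main_time_def find_time_def member_time_def solve_time_def extend_time_def lookup_time_def
  by (intro poly_fun_const poly_fun_id poly_fun_add poly_fun_mult)

theorem theorem3:
  shows "\<exists>(P :: program) (p :: nat poly). \<forall>(n :: nat) (es :: (nat \<times> nat) list).
    presents_tree n es \<longrightarrow>
      (\<exists>(col :: nat set \<Rightarrow> nat) (t :: nat).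
        is_arg_min (largest_group_size (edge_of ` set es))
          (edge_2_coloring {..<n} (edge_of ` set es)) col \<and>
        computes_in_time P (enc_input n es)
          (enc_output (largest_group_size (edge_of ` set es) col) es col) t \<and>
        t \<le> poly p n)"
proof -
  \<comment> \<open>The 2 pays for the initial call and its argument, the last summand for writing
    out the result.\<close>
  obtain p :: "nat poly" where p: "\<And>n. main_time (n + 1) + 2 + (n + n * (n + 1) + 1) = poly p n"
    using poly_fun_time unfolding poly_fun_def by blast
  show ?thesis
  proof (rule exI[of _ prog], rule exI[of _ p], intro allI impI)
    fix n es assume pres: "presents_tree n es"
    let ?E = "edge_of ` set es"
    let ?size = "largest_group_size ?E"
    define K where "K = (LEAST k. solve k (rooted n es) [] \<noteq> [])"
    define col where "col = tree_coloring K n es"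
    have least: "K \<le> ?size c" if "edge_2_coloring {..<n} ?E c" for c :: "nat set \<Rightarrow> nat"
      unfolding K_def by (rule Least_le) (rule solve_rooted_complete[OF pres that order_refl])
    \<comment> \<open>The coloring with a single color serves twice: it shows that some bound
      succeeds, and it gives \<open>K < n\<close>, which keeps the search and the tables
      polynomial.\<close>
    have const: "edge_2_coloring {..<n} ?E (\<lambda>_. 0 :: nat)"
      by (auto simp: edge_2_coloring_def image_constant_conv)
    have K: "solve K (rooted n es) [] \<noteq> []"
      unfolding K_def by (rule LeastI) (rule solve_rooted_complete[OF pres const order_refl])
    have min: "\<forall>j < K. solve j (rooted n es) [] = []"
      unfolding K_def using not_less_Least by blast
    have "card (color_group ?E (\<lambda>_. 0 :: nat) d) \<le> length es" for d
    proof -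
      have "card (color_group ?E (\<lambda>_. 0 :: nat) d) \<le> card ?E"
        by (rule card_mono) (auto simp: color_group_def)
      also have "\<dots> \<le> length es" by (metis card_length list.set_map length_map)
      finally show ?thesis .
    qed
    then have "?size (\<lambda>_. 0 :: nat) \<le> length es" by (simp add: largest_group_size_le_iff)
    then have Kn: "K < n" using least[OF const] length_es[OF pres] by simp
    \<comment> \<open>Soundness gives one inequality; the other is \<open>least\<close> applied to
      the computed coloring itself.\<close>
    have size: "?size col = K"
      using solve_rooted_sound[OF pres K] least unfolding col_def by (meson antisym)
    have "is_arg_min ?size (edge_2_coloring {..<n} ?E) col"
      unfolding is_arg_min_def size
      using solve_rooted_sound(1)[OF pres K] least by (auto simp: col_def not_less)
    moreover obtain s where s: "eval prog [enc_input n es] (ECall 0 [EVar 0]) (enc_output K es col) s"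
      "s \<le> main_time (n + 1) + 2"
    proof -
      have "wp prog [enc_input n es] (ECall 0 [EVar 0])
          (\<lambda>v s. v = enc_output K es col \<and> s \<le> main_time (n + 1) + 2)"
        unfolding col_def
        by (simp, rule wp_call_calls[OF calls_main[OF pres K min Kn]]) simp
      then show thesis using that by (auto simp: wp_def)
    qed
    moreover have "s + size (enc_output K es col) \<le> poly p n"
      using s(2) size_enc_output[OF pres K Kn] by (simp add: p[symmetric] col_def)
    ultimately show "\<exists>col t. is_arg_min ?size (edge_2_coloring {..<n} ?E) col \<and>
        computes_in_time prog (enc_input n es) (enc_output (?size col) es col) t \<and> t \<le> poly p n"
      unfolding computes_in_time_def using size by metis
  qed
qed

end
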